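(* Let $(\Omega,\mathsf{F},\mathbb{P})$ and $(E,\mathsf{E},\mu)$ be probability spaces, with $(E,\mathsf{E},\mu)$ complete, and let $(\mathcal{H},d)$ be a locally compact Hadamard space. Let $(\xi_i)_{i\ge1}$ be an i.i.d. sequence of random variables $\xi_i:\Omega\to E$ with distribution $\mu$. Let $f:E\times\mathcal{H}\to(-\infty,+\infty]$ be a proper normal convex integrand which is $L^1$-Lipschitz, and suppose there exists $u_0\in\mathcal{H}$ such that $f(\cdot,u_0)\in L^1(E,\mathbb{R},\mu)$. Let $S_t(x)$ denote the gradient flow semigroup associated with $x\mapsto\int f(e,x)\,d\mu(e)$. Then there exists a set $\Omega'\subseteq\Omega$ with $\mathbb{P}(\Omega')=1$ such that for every $\omega\in\Omega'$, every $t\ge0$ and every $x\in\mathcal{H}$: \[ S_t(x)=\lim_{n\to\infty}\left(\mathrm{prox}_{\frac{t}{n^2}f(\xi_n(\omega),\cdot)}\circ\dots\circ\mathrm{prox}_{\frac{t}{n^2}f(\xi_1(\omega),\cdot)}\right)^{(n)}(x). \] In particular, for every $t\ge0$ and every $x\in\mathcal{H}$, the limit $S_t(x)=\lim_{n\to\infty}\left(\mathrm{prox}_{\frac{t}{n^2}f(\xi_n,\cdot)}\circ\dots\circ\mathrm{prox}_{\frac{t}{n^2}f(\xi_1,\cdot)}\right)^{(n)}(x)$ holds $\mathbb{P}$-almost surely.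
   Context: A Hadamard space is a complete metric space $(\mathcal{H},d)$ in which any two points are joined by a geodesic (an isometric embedding $\gamma:[0,l]\to\mathcal{H}$) and such that $d^2(\gamma(tl),x)\le(1-t)d^2(\gamma(0),x)+td^2(\gamma(l),x)-t(1-t)d^2(\gamma(0),\gamma(l))$ for all $x\in\mathcal{H}$, $t\in[0,1]$ and all geodesics $\gamma:[0,l]\to\mathcal{H}$. Convexity of functions on $\mathcal{H}$ means convexity along geodesics. $f:E\times\mathcal{H}\to(-\infty,+\infty]$ is a normal integrand if $f(e,\cdot)$ is lower-semicontinuous for all $e\in E$ and the set-valued map $e\mapsto\{(x,\alpha)\in\mathcal{H}\times\mathbb{R}\mid f(e,x)\le\alpha\}$ is measurable (for every closed set $C$, the set of $e$ whose image meets $C$ is in $\mathsf{E}$); for complete $(E,\mathsf{E},\mu)$ the measurability can equivalently be replaced by $\mathsf{E}\otimes\mathsf{B}(\mathcal{H})$-measurability of $f$. It is a normal convex integrand if moreover every $f(e,\cdot)$ is convex, and proper if every $f(e,\cdot)$ is proper. $f$ is $L^1$-Lipschitz if there is $L\in L^1(E,(0,\infty),\mu)$ such that $|f(e,x)-f(e,y)|\le L(e)d(x,y)$ for all $x,y\in\mathcal{H}$ and $e\in E$. For $h:\mathcal{H}\to(-\infty,+\infty]$ proper, convex and lower-semicontinuous and $\lambda>0$, $\mathrm{prox}_{\lambda h}(x)=\mathrm{argmin}_{y\in\mathcal{H}}\{h(y)+\frac1{2\lambda}d^2(x,y)\}$ (a single point), and $\mathrm{prox}_{0\cdot h}$ is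 the identity. The gradient flow semigroup associated with $h$ is $S_t(x)=\lim_{k\to\infty}(\mathrm{prox}_{\frac tk h})^{(k)}(x)$ for $t>0$ and $S_0(x)=x$. $Q^{(n)}$ denotes the $n$-fold iterate of a map $Q$. *)

theory Defs
  imports "HOL-Probability.Probability"
begin

section \<open>Hadamard spaces\<close>

definition geodesic :: "real \<Rightarrow> (real \<Rightarrow> 'a::metric_space) \<Rightarrow> bool" where
  "geodesic l \<gamma> \<longleftrightarrow> 0 \<le> l \<and> (\<forall>s\<in>{0..l}. \<forall>t\<in>{0..l}. dist (\<gamma> s) (\<gamma> t) = \<bar>s - t\<bar>)"

class hadamard_space = complete_space +
  assumes geodesic_exists: "\<exists>l \<gamma>. geodesic l \<gamma> \<and> \<gamma> 0 = x \<and> \<gamma> l = y"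
    and CN_inequality: "\<lbrakk>geodesic l \<gamma>; 0 \<le> t; t \<le> 1\<rbrakk> \<Longrightarrow>
      (dist (\<gamma> (t * l)) x)\<^sup>2 \<le> (1 - t) * (dist (\<gamma> 0) x)\<^sup>2 + t * (dist (\<gamma> l) x)\<^sup>2
         - t * (1 - t) * (dist (\<gamma> 0) (\<gamma> l))\<^sup>2"


section \<open>Extended-real-valued functions\<close>

text \<open>Functions with values in $(-\infty,+\infty]$ are represented as \<^typ>\<open>ereal\<close>-valued functions
  that avoid \<^term>\<open>- \<infinity>::ereal\<close>; this is part of \<open>proper_fun\<close> and \<open>normal_integrand\<close> below.\<close>

definition proper_fun :: "('a \<Rightarrow> ereal) \<Rightarrow> bool" where
  "proper_fun h \<longleftrightarrow> (\<forall>x. h x \<noteq> - \<infinity>) \<and> (\<exists>x. h x \<noteq> \<infinity>)"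

definition lower_semicontinuous :: "('a::topological_space \<Rightarrow> ereal) \<Rightarrow> bool" where
  "lower_semicontinuous h \<longleftrightarrow> (\<forall>x. h x \<le> Liminf (at x) h)"

text \<open>At the endpoints this relies on \<open>0 * \<infinity> = 0\<close> in \<^typ>\<open>ereal\<close>.\<close>

definition geodesically_convex :: "('a::metric_space \<Rightarrow> ereal) \<Rightarrow> bool" where
  "geodesically_convex h \<longleftrightarrow> (\<forall>l \<gamma> t. geodesic l \<gamma> \<and> 0 \<le> t \<and> t \<le> 1 \<longrightarrow>
     h (\<gamma> (t * l)) \<le> ereal (1 - t) * h (\<gamma> 0) + ereal t * h (\<gamma> l))"

definition epigraph :: "('a \<Rightarrow> ereal) \<Rightarrow> ('a \<times> real) set" where
  "epigraph h = {(x, \<alpha>). h x \<le> ereal \<alpha>}"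


section \<open>Normal integrands\<close>

definition normal_integrand :: "'e measure \<Rightarrow> ('e \<Rightarrow> 'a::metric_space \<Rightarrow> ereal) \<Rightarrow> bool" where
  "normal_integrand M f \<longleftrightarrow>
     (\<forall>e\<in>space M. \<forall>x. f e x \<noteq> - \<infinity>) \<and>
     (\<forall>e\<in>space M. lower_semicontinuous (f e)) \<and>
     (\<forall>C. closed C \<longrightarrow> {e \<in> space M. epigraph (f e) \<inter> C \<noteq> {}} \<in> sets M)"

definition normal_convex_integrand :: "'e measure \<Rightarrow> ('e \<Rightarrow> 'a::metric_space \<Rightarrow> ereal) \<Rightarrow> bool" where
  "normal_convex_integrand M f \<longleftrightarrow>
     normal_integrand M f \<and> (\<forall>e\<in>space M. geodesically_convex (f e))"

definition proper_integrand :: "'e measure \<Rightarrow> ('e \<Rightarrow> 'a \<Rightarrow> ereal) \<Rightarrow> bool" where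
  "proper_integrand M f \<longleftrightarrow> (\<forall>e\<in>space M. proper_fun (f e))"

text \<open>In \<^typ>\<open>ereal\<close>, \<open>\<bar>\<infinity> - r\<bar> = \<bar>\<infinity> - \<infinity>\<bar> = \<infinity>\<close>, so this condition forces finite values.  For a proper
  integrand that is no extra restriction: the inequality at a point where \<open>f e\<close> is finite already
  makes \<open>f e\<close> finite everywhere.\<close>

definition L1_Lipschitz :: "'e measure \<Rightarrow> ('e \<Rightarrow> 'a::metric_space \<Rightarrow> ereal) \<Rightarrow> bool" where
  "L1_Lipschitz M f \<longleftrightarrow> (\<exists>L::'e \<Rightarrow> real. integrable M L \<and> (\<forall>e\<in>space M. 0 < L e) \<and>
     (\<forall>e\<in>space M. \<forall>x y. \<bar>f e x - f e y\<bar> \<le> ereal (L e * dist x y)))"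

text \<open>Membership in $L^1(E,\mathbb{R},\mu)$ of an extended-real-valued function.\<close>

definition real_L1 :: "'e measure \<Rightarrow> ('e \<Rightarrow> ereal) \<Rightarrow> bool" where
  "real_L1 M g \<longleftrightarrow> (\<forall>e\<in>space M. \<bar>g e\<bar> \<noteq> \<infinity>) \<and> integrable M (\<lambda>e. real_of_ereal (g e))"

text \<open>The integral of the positive part minus the integral of the negative part; \<^const>\<open>e2ennreal\<close>
  maps negative numbers to \<open>0\<close>.\<close>

definition ereal_integral :: "'e measure \<Rightarrow> ('e \<Rightarrow> ereal) \<Rightarrow> ereal" where
  "ereal_integral M g =
     enn2ereal (\<integral>\<^sup>+ e. e2ennreal (g e) \<partial>M) - enn2ereal (\<integral>\<^sup>+ e. e2ennreal (- g e) \<partial>M)"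


section \<open>Proximal maps and gradient flows\<close>

text \<open>For a proper, convex, lower-semicontinuous function on a Hadamard space and \<open>\<eta> > 0\<close> the
  minimiser is unique, so the definite description denotes it.\<close>

definition prox :: "real \<Rightarrow> ('a::metric_space \<Rightarrow> ereal) \<Rightarrow> 'a \<Rightarrow> 'a" where
  "prox \<eta> h x = (if \<eta> = 0 then x
     else (THE y. is_arg_min (\<lambda>y. h y + ereal (1 / (2 * \<eta>) * (dist x y)\<^sup>2)) (\<lambda>_. True) y))"

definition gradient_flow :: "('a::metric_space \<Rightarrow> ereal) \<Rightarrow> real \<Rightarrow> 'a \<Rightarrow> 'a" where
  "gradient_flow h t x = (if t = 0 then x else lim (\<lambda>k. (prox (t / real k) h ^^ k) x))"

text \<open>\<open>prox_cycle s h n\<close> is the composition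
  $\mathrm{prox}_{s\,h_n} \circ \dots \circ \mathrm{prox}_{s\,h_1}$, with \<open>h 1\<close> applied first.\<close>

definition prox_cycle :: "real \<Rightarrow> (nat \<Rightarrow> 'a::metric_space \<Rightarrow> ereal) \<Rightarrow> nat \<Rightarrow> 'a \<Rightarrow> 'a" where
  "prox_cycle s h n = fold (\<lambda>i. prox s (h i)) [1..<Suc n]"

end

theory Submission
  imports Defs
begin

text \<open>The variational inequality of a proximal step is
  \<open>d\<^sup>2(y,z) \<le> d\<^sup>2(x,z) - 2 s (h y - h z)\<close> with \<open>y = prox\<^sub>s\<^sub>h x\<close>.  Summing it over one cycle of
  \<open>n\<close> steps of size \<open>\<tau>/n\<close> shows that the cycle satisfies the same inequality with step \<open>\<tau>\<close>
  for the average \<open>A\<^sub>n\<close> of the functions, up to an error \<open>2 \<tau>\<^sup>2 K\<^sup>2\<close>, where \<open>K\<close> bounds the average of the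
  Lipschitz constants.  Applying two such inequalities to each other's iterates bounds the distance
  between the trajectories of \<open>A\<^sub>n\<close> and of the integral functional \<open>F\<close> by
  \<open>4 t sup |A\<^sub>n - F| + 6 t\<^sup>2 K\<^sup>2/n\<close>, the supremum being taken over a fixed ball.  Balls are compact by the
  Hopf--Rinow theorem, and the strong law of large numbers at countably many points, with the equi-Lipschitz
  property, makes that supremum tend to zero almost surely.  The same comparison, for the constant
  sequence \<open>F\<close>, gives the convergence of the exponential formula.\<close>

section \<open>Compactness of closed balls\<close>

text \<open>Inequalities along a geodesic are first divided by \<open>t > 0\<close>; this is the
  subsequent passage to the limit as \<open>t\<close> tends to 0 from the right.\<close>

lemma le_diff_if_le_diff_scaled:
  fixes a b c :: real
  assumes "\<And>t. 0 < t \<Longrightarrow> t \<le> 1 \<Longrightarrow> a \<le> b - (1 - t) * c"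
  shows "a \<le> b - c"
proof -
  have "((\<lambda>t. b - (1 - t) * c) \<longlongrightarrow> b - (1 - 0) * c) (at_right 0)"
    by (intro tendsto_intros)
  moreover have "\<forall>\<^sub>F t in at_right (0::real). a \<le> b - (1 - t) * c"
    unfolding eventually_at_right_field using assms by (intro exI[of _ 1]) auto
  ultimately show ?thesis
    by (intro tendsto_lowerbound[of "\<lambda>t. b - (1 - t) * c" _ "at_right 0" a]) auto
qed

text \<open>Parameter differences on a geodesic are distances, so the point at parameter
  \<open>min r l\<close> works. Geometrically, the ball of radius \<open>r + \<delta>\<close> stays
  within \<open>\<delta>\<close> of the ball of radius \<open>r\<close>; Hopf--Rinow uses geodesics
  only through this.\<close>

lemma point_at_distance_on_geodesic:
  fixes x y :: "'a::hadamard_space"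
  assumes "dist x y \<le> r + \<delta>" "0 \<le> r" "0 \<le> \<delta>"
  obtains z where "dist x z \<le> r" "dist z y \<le> \<delta>"
proof -
  obtain l \<gamma> where \<gamma>: "geodesic l \<gamma>" "\<gamma> 0 = x" "\<gamma> l = y"
    using geodesic_exists by blast
  then have *: "l \<ge> 0" "\<And>s t. s \<in> {0..l} \<Longrightarrow> t \<in> {0..l} \<Longrightarrow> dist (\<gamma> s) (\<gamma> t) = \<bar>s - t\<bar>"
    by (auto simp: geodesic_def)
  have "dist x y = l" using *(2)[of 0 l] * \<gamma> by auto
  show thesis
  proof (rule that[of "\<gamma> (min r l)"])
    show "dist x (\<gamma> (min r l)) \<le> r"
      using *(2)[of 0 "min r l"] * \<gamma> assms by auto
    show "dist (\<gamma> (min r l)) y \<le> \<delta>"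
      using *(2)[of "min r l" l] * \<gamma> assms \<open>dist x y = l\<close> by (auto simp: min_def)
  qed
qed

text \<open>Hopf--Rinow: the supremum of the radii of compact balls about \<open>x\<close> cannot be finite.\<close>

theorem compact_cball_hadamard:
  fixes x :: "'a::hadamard_space"
  assumes loc: "locally compact (UNIV :: 'a set)"
  shows "compact (cball x r)"
proof -
  have nbhd: "\<exists>e>0. compact (cball z e)" for z :: 'a
  proof -
    obtain u v where uv: "open u" "compact v" "z \<in> u" "u \<subseteq> v"
      using loc[unfolded locally_def, rule_format, of UNIV z] by auto
    then obtain e where "e > 0" "cball z e \<subseteq> u"
      using open_contains_cball by blast
    moreover have "cball z e = v \<inter> cball z e" using uv calculation by auto
    ultimately show ?thesis using uv compact_Int_closed[of v "cball z e"] by auto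
  qed
  define R where "R = {r. r \<ge> 0 \<and> compact (cball x r)}"
  have down: "s \<in> R" if "r \<in> R" "0 \<le> s" "s \<le> r" for r s
  proof -
    have "cball x s = cball x r \<inter> cball x s" using that by auto
    then show ?thesis using that compact_Int_closed[of "cball x r" "cball x s"]
      by (auto simp: R_def)
  qed
  have "0 \<in> R" by (auto simp: R_def)
  have nb: "\<not> bdd_above R"
  proof
    assume bdd: "bdd_above R"
    define S where "S = Sup R"
    have S0: "S \<ge> 0" unfolding S_def using \<open>0 \<in> R\<close> bdd by (simp add: cSup_upper)
    have below: "s \<in> R" if "0 \<le> s" "s < S" for s
      using that less_cSupD[of R s] down \<open>0 \<in> R\<close> unfolding S_def by fastforce
    have "compact (cball x S)"
      unfolding compact_eq_totally_bounded complete_eq_closed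
    proof (intro conjI allI impI)
      show "closed (cball x S)" by (rule closed_cball)
      fix e :: real assume "e > 0"
      \<comment> \<open>This radius lies in \<open>R\<close>: either \<open>s < S\<close>, or
        \<open>S = 0\<close> and \<open>s = 0\<close>. A finite \<open>e/3\<close>-net of the
        smaller ball is an \<open>e\<close>-net of the ball of radius \<open>S\<close>, as each
        point of the latter is within \<open>e/3\<close> of the former.\<close>
      define s where "s = max 0 (S - e/3)"
      have s: "0 \<le> s" "S \<le> s + e/3" by (auto simp: s_def)
      have "s \<in> R" using below[of s] \<open>e > 0\<close> S0 \<open>0 \<in> R\<close> by (cases "S = 0") (auto simp: s_def max_def)
      moreover have "e/3 > 0" using \<open>e > 0\<close> by simp
      ultimately obtain k where k: "finite k" "cball x s \<subseteq> (\<Union>y\<in>k. ball y (e/3))"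
        unfolding R_def compact_eq_totally_bounded by blast
      have "cball x S \<subseteq> (\<Union>y\<in>k. ball y e)"
      proof
        fix y assume "y \<in> cball x S"
        then obtain z where z: "dist x z \<le> s" "dist z y \<le> e/3"
          using point_at_distance_on_geodesic[of x y s "e/3"] \<open>e > 0\<close> s by auto
        then obtain w where "w \<in> k" "dist w z < e/3" using k by (auto simp: subset_iff)
        with z \<open>e > 0\<close> have "dist w y < e" using dist_triangle[of w y z] by linarith
        with \<open>w \<in> k\<close> show "y \<in> (\<Union>y\<in>k. ball y e)" by auto
      qed
      with k show "\<exists>k. finite k \<and> cball x S \<subseteq> (\<Union>y\<in>k. ball y e)" by blast
    qed
    \<comment> \<open>Finitely many balls whose closed balls are compact cover the ball of radius
      \<open>S\<close> and, by its compactness, a whole \<open>e\<close>-neighbourhood of it. The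
      ball of radius \<open>S + e/2\<close> is then a closed part of a compact set, against the
      choice of \<open>S\<close>.\<close>
    obtain \<rho> where \<rho>: "\<And>z. \<rho> z > 0" "\<And>z::'a. compact (cball z (\<rho> z))"
      using nbhd by metis
    have "cball x S \<subseteq> (\<Union>z\<in>cball x S. ball z (\<rho> z))"
      using \<rho> by force
    then obtain D where D: "D \<subseteq> cball x S" "finite D" "cball x S \<subseteq> (\<Union>z\<in>D. ball z (\<rho> z))"
      using compactE_image[OF \<open>compact (cball x S)\<close>, of "cball x S" "\<lambda>z. ball z (\<rho> z)"] by auto
    have "open (\<Union>z\<in>D. ball z (\<rho> z))" by auto
    then obtain e where e: "e > 0" "(\<Union>y\<in>cball x S. ball y e) \<subseteq> (\<Union>z\<in>D. ball z (\<rho> z))"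
      using compact_subset_open_imp_ball_epsilon_subset[OF \<open>compact (cball x S)\<close> _ D(3)] by metis
    have sub: "cball x (S + e/2) \<subseteq> (\<Union>z\<in>D. cball z (\<rho> z))"
    proof
      fix y assume "y \<in> cball x (S + e/2)"
      then obtain z where z: "dist x z \<le> S" "dist z y \<le> e/2"
        using point_at_distance_on_geodesic[of x y S "e/2"] \<open>e > 0\<close> S0 by auto
      then have "y \<in> (\<Union>y\<in>cball x S. ball y e)" using e by force
      then show "y \<in> (\<Union>z\<in>D. cball z (\<rho> z))" using e by force
    qed
    have "compact (\<Union>z\<in>D. cball z (\<rho> z))" using D \<rho> by (intro compact_UN) auto
    then have "compact (cball x (S + e/2))"
      using compact_Int_closed[of _ "cball x (S + e/2)"] sub by (metis closed_cball inf.absorb2)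
    then have "S + e/2 \<in> R" using S0 e by (auto simp: R_def)
    then have "S + e/2 \<le> S" unfolding S_def using bdd by (rule cSup_upper)
    with e show False by simp
  qed
  then obtain s where "s \<in> R" "s > max 0 r" by (meson bdd_above.I not_le_imp_less)
  then have "max 0 r \<in> R" using down[of s "max 0 r"] by auto
  then show ?thesis by (cases "r \<ge> 0") (auto simp: R_def)
qed

section \<open>Proximal steps and cycles\<close>

lemma geodesically_convexD:
  fixes h :: "'a::metric_space \<Rightarrow> real"
  assumes "geodesically_convex (\<lambda>x. ereal (h x))" "geodesic l \<gamma>" "0 \<le> t" "t \<le> 1"
  shows "h (\<gamma> (t * l)) \<le> (1 - t) * h (\<gamma> 0) + t * h (\<gamma> l)"
  using assms unfolding geodesically_convex_def by fastforce

text \<open>The minimiser is tested against the points of the geodesic from \<open>y\<close> to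
  \<open>z\<close>. The CN inequality supplies the term
  \<open>t * (1 - t) * (dist y z)\<^sup>2\<close>; then one divides by \<open>t\<close> and lets
  \<open>t\<close> tend to 0.\<close>

lemma regularized_minimizer_variational:
  fixes h :: "'a::hadamard_space \<Rightarrow> real"
  assumes conv: "geodesically_convex (\<lambda>x. ereal (h x))" and "s > 0"
    and min: "\<And>z. h y + (dist x y)\<^sup>2 / (2 * s) \<le> h z + (dist x z)\<^sup>2 / (2 * s)"
  shows "(dist y z)\<^sup>2 \<le> (dist x z)\<^sup>2 - 2 * s * (h y - h z) - (dist x y)\<^sup>2"
proof -
  obtain l \<gamma> where \<gamma>: "geodesic l \<gamma>" "\<gamma> 0 = y" "\<gamma> l = z"
    using geodesic_exists by blast
  have "2 * s * h y + (dist x y)\<^sup>2 \<le> 2 * s * h z + (dist x z)\<^sup>2 - (1 - t) * (dist y z)\<^sup>2"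
    if t: "0 < t" "t \<le> 1" for t
  proof -
    have 1: "(dist (\<gamma> (t * l)) x)\<^sup>2 \<le> (1 - t) * (dist y x)\<^sup>2 + t * (dist z x)\<^sup>2 - t * (1 - t) * (dist y z)\<^sup>2"
      using CN_inequality[OF \<gamma>(1), of t x] t \<gamma> by simp
    have 2: "h (\<gamma> (t * l)) \<le> (1 - t) * h y + t * h z"
      using geodesically_convexD[OF conv \<gamma>(1), of t] t \<gamma> by simp
    have "2 * s * h y + (dist x y)\<^sup>2 \<le> 2 * s * h (\<gamma> (t * l)) + (dist x (\<gamma> (t * l)))\<^sup>2"
      using mult_left_mono[OF min[of "\<gamma> (t * l)"], of "2 * s"] \<open>s > 0\<close> by (simp add: distrib_left)
    also have "\<dots> \<le> 2 * s * ((1 - t) * h y + t * h z) +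
        ((1 - t) * (dist x y)\<^sup>2 + t * (dist x z)\<^sup>2 - t * (1 - t) * (dist y z)\<^sup>2)"
      using 1 2 \<open>s > 0\<close> by (intro add_mono mult_left_mono) (auto simp: dist_commute)
    finally have "t * (2 * s * h y + (dist x y)\<^sup>2) \<le>
        t * (2 * s * h z + (dist x z)\<^sup>2 - (1 - t) * (dist y z)\<^sup>2)"
      by (simp add: algebra_simps)
    with t show ?thesis by simp
  qed
  from le_diff_if_le_diff_scaled[OF this] show ?thesis by (simp add: algebra_simps)
qed

text \<open>Compact balls and Lipschitz growth give existence of the minimiser, the variational
  inequality gives its uniqueness, and only then does the definite description in
  \<open>prox\<close> denote it. The displacement bound is the variational inequality at
  \<open>z = x\<close>.\<close>

lemma prox_real:
  fixes h :: "'a::hadamard_space \<Rightarrow> real"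
  assumes cb: "\<And>(x::'a) r. compact (cball x r)"
    and conv: "geodesically_convex (\<lambda>x. ereal (h x))" and lip: "L-lipschitz_on UNIV h" and s: "s \<ge> 0"
  shows prox_variational: "(dist (prox s (\<lambda>x. ereal (h x)) x) z)\<^sup>2 \<le> (dist x z)\<^sup>2
      - 2 * s * (h (prox s (\<lambda>x. ereal (h x)) x) - h z) - (dist x (prox s (\<lambda>x. ereal (h x)) x))\<^sup>2"
    and prox_displacement: "dist x (prox s (\<lambda>x. ereal (h x)) x) \<le> s * L"
proof -
  define y where "y = prox s (\<lambda>x. ereal (h x)) x"
  have L: "L \<ge> 0" using lip by (rule lipschitz_on_nonneg)
  have lip': "h z \<le> h w + L * dist z w" for z w
    using lipschitz_onD[OF lip, of z w] by (auto simp: dist_real_def)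
  have var: "(dist y z)\<^sup>2 \<le> (dist x z)\<^sup>2 - 2 * s * (h y - h z) - (dist x y)\<^sup>2" for z
  proof (cases "s = 0")
    case True
    then show ?thesis by (simp add: y_def prox_def)
  next
    case False
    with s have "s > 0" by simp
    define \<phi> where "\<phi> = (\<lambda>z. h z + (dist x z)\<^sup>2 / (2 * s))"
    \<comment> \<open>The radius is chosen so that outside the ball the quadratic term is at least
      \<open>L * dist x z\<close>; there \<open>\<phi> z\<close> is at least
      \<open>\<phi> x\<close>, so a minimum over the ball is global.\<close>
    have "continuous_on (cball x (2 * s * L)) \<phi>"
      unfolding \<phi>_def
      by (intro continuous_intros continuous_on_subset[OF lipschitz_on_continuous_on[OF lip]])
        (use \<open>s > 0\<close> in auto)
    then obtain m where m: "m \<in> cball x (2 * s * L)" "\<And>z. z \<in> cball x (2 * s * L) \<Longrightarrow> \<phi> m \<le> \<phi> z"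
      using continuous_attains_inf[OF cb, of x "2 * s * L" \<phi>] mult_nonneg_nonneg[OF L s]
      by (auto simp: not_less)
    have min: "\<phi> m \<le> \<phi> z" for z
    proof (cases "z \<in> cball x (2 * s * L)")
      case False
      then have "2 * s * L * dist x z \<le> dist x z * dist x z"
        by (intro mult_right_mono) auto
      then have "L * dist x z \<le> (dist x z)\<^sup>2 / (2 * s)"
        using \<open>s > 0\<close> by (simp add: field_simps power2_eq_square)
      then have "\<phi> x \<le> \<phi> z" unfolding \<phi>_def using lip'[of x z] by simp
      with m(2)[of x] s L show ?thesis by force
    qed (use m in auto)
    have *: "is_arg_min (\<lambda>z. ereal (h z) + ereal (1 / (2 * s) * (dist x z)\<^sup>2)) (\<lambda>_. True) y'
        \<longleftrightarrow> (\<forall>z. \<phi> y' \<le> \<phi> z)" for y'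
      by (simp add: is_arg_min_linorder \<phi>_def)
    \<comment> \<open>Two minimisers have equal \<open>\<phi>\<close>-values, and then the
      variational inequality of one, tested at the other, reduces to
      \<open>(dist m y')\<^sup>2 \<le> 0\<close>.\<close>
    have "y = m"
      unfolding y_def prox_def * using \<open>s \<noteq> 0\<close>
    proof (simp, intro the_equality allI min)
      fix y' assume y': "\<forall>z. \<phi> y' \<le> \<phi> z"
      have "\<phi> m = \<phi> y'" using y' min by (simp add: order_antisym)
      then have "2 * s * h m + (dist x m)\<^sup>2 = 2 * s * h y' + (dist x y')\<^sup>2"
        using \<open>s > 0\<close> by (simp add: \<phi>_def field_simps)
      moreover have "(dist m y')\<^sup>2 \<le> (dist x y')\<^sup>2 - 2 * s * (h m - h y') - (dist x m)\<^sup>2"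
        using regularized_minimizer_variational[OF conv \<open>s > 0\<close>, of m x y'] min by (simp add: \<phi>_def)
      ultimately have "(dist m y')\<^sup>2 \<le> 0" by (simp add: algebra_simps)
      then show "y' = m" by simp
    qed
    then show ?thesis
      using regularized_minimizer_variational[OF conv \<open>s > 0\<close>, of m x z] min by (simp add: \<phi>_def)
  qed
  then show "(dist (prox s (\<lambda>x. ereal (h x)) x) z)\<^sup>2 \<le> (dist x z)\<^sup>2
      - 2 * s * (h (prox s (\<lambda>x. ereal (h x)) x) - h z) - (dist x (prox s (\<lambda>x. ereal (h x)) x))\<^sup>2"
    unfolding y_def .
  \<comment> \<open>Keeping \<open>(dist x y)\<^sup>2\<close> in the variational inequality doubles
    the left side; hence the bound \<open>s * L\<close> and not \<open>2 * s * L\<close>.\<close>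
  have "2 * (dist x y)\<^sup>2 \<le> 2 * s * (h x - h y)"
    using var[of x] by (simp add: dist_commute algebra_simps)
  also have "\<dots> \<le> 2 * s * (L * dist x y)"
    using lip'[of x y] s by (intro mult_left_mono) auto
  finally have "dist x y * dist x y \<le> (s * L) * dist x y"
    by (simp add: power2_eq_square)
  then have "dist x y \<le> s * L"
    using s L by (cases "dist x y = 0") (auto simp: mult_le_cancel_right)
  then show "dist x (prox s (\<lambda>x. ereal (h x)) x) \<le> s * L" unfolding y_def .
qed

section \<open>Cycles of proximal steps\<close>

lemma prox_cycle_Suc:
  "prox_cycle s h (Suc n) x = prox s (h (Suc n)) (prox_cycle s h n x)"
  by (simp add: prox_cycle_def)

lemma prox_cycle_0 [simp]: "prox_cycle s h 0 x = x"
  by (simp add: prox_cycle_def)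

text \<open>Through this identity the estimates for cycles also cover the iterates that define the
  gradient flow.\<close>

lemma prox_cycle_const: "prox_cycle s (\<lambda>_. h) n = prox s h ^^ n"
  by (induction n) (auto simp: fun_eq_iff prox_cycle_Suc)

text \<open>Induction on the cycle. The last step produces the value of \<open>h (Suc n)\<close> at
  its own end point, whereas the claim wants it at the starting point \<open>x\<close>; the exchange
  costs a Lipschitz constant times the displacement so far, which is why both estimates are proved
  together.\<close>

lemma prox_cycle_variational:
  fixes h :: "nat \<Rightarrow> 'a::hadamard_space \<Rightarrow> real"
  assumes cb: "\<And>(x::'a) r. compact (cball x r)"
    and conv: "\<And>i. i \<ge> 1 \<Longrightarrow> geodesically_convex (\<lambda>x. ereal (h i x))"
    and lip: "\<And>i. i \<ge> 1 \<Longrightarrow> (L i)-lipschitz_on UNIV (h i)" and s: "s \<ge> 0"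
  defines "Q \<equiv> prox_cycle s (\<lambda>i x. ereal (h i x))"
  shows "dist x (Q n x) \<le> s * (\<Sum>i=1..n. L i) \<and>
    (dist (Q n x) z)\<^sup>2 \<le> (dist x z)\<^sup>2 - 2 * s * ((\<Sum>i=1..n. h i x) - (\<Sum>i=1..n. h i z))
      + 2 * s\<^sup>2 * (\<Sum>i=1..n. L i)\<^sup>2"
proof (induction n)
  case 0
  then show ?case by (simp add: Q_def)
next
  case (Suc n)
  define y where "y = Q n x"
  define y' where "y' = Q (Suc n) x"
  define \<Lambda> where "\<Lambda> = (\<Sum>i=1..n. L i)"
  define l where "l = L (Suc n)"
  have l: "l \<ge> 0" using lipschitz_on_nonneg[OF lip[of "Suc n"]] by (simp add: l_def)
  have \<Lambda>: "\<Lambda> \<ge> 0" unfolding \<Lambda>_def using lipschitz_on_nonneg[OF lip] by (intro sum_nonneg) auto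
  have y': "y' = prox s (\<lambda>x. ereal (h (Suc n) x)) y"
    by (simp add: y'_def y_def Q_def prox_cycle_Suc)
  have hn: "geodesically_convex (\<lambda>x. ereal (h (Suc n) x))" "l-lipschitz_on UNIV (h (Suc n))"
    using conv[of "Suc n"] lip[of "Suc n"] by (simp_all add: l_def)
  note pv = prox_variational[OF cb hn s, of y z, folded y']
    and pd = prox_displacement[OF cb hn s, of y, folded y']
  have d: "dist x y' \<le> s * (\<Lambda> + l)"
    using dist_triangle[of x y' y] pd Suc by (simp add: y_def \<Lambda>_def algebra_simps)
  have "h (Suc n) x - h (Suc n) y' \<le> l * dist x y'"
    using lipschitz_onD[OF lip[of "Suc n"], of x y'] by (simp add: l_def dist_real_def)
  also have "\<dots> \<le> l * (s * (\<Lambda> + l))" using d l by (intro mult_left_mono)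
  finally have "2 * s * (h (Suc n) x - h (Suc n) y') \<le> 2 * s * (l * (s * (\<Lambda> + l)))"
    using s by (intro mult_left_mono) auto
  then have 1: "- 2 * s * h (Suc n) y' \<le> - 2 * s * h (Suc n) x + 2 * s\<^sup>2 * (l * (\<Lambda> + l))"
    by (simp add: power2_eq_square algebra_simps)
  \<comment> \<open>The squared sum of the constants grows by
    \<open>2 * \<Lambda> * l + l\<^sup>2\<close>, enough to pay the exchange cost
    \<open>l * (\<Lambda> + l)\<close>.\<close>
  have "s\<^sup>2 * (\<Lambda>\<^sup>2 + l * (\<Lambda> + l)) \<le> s\<^sup>2 * (\<Lambda> + l)\<^sup>2"
    using l \<Lambda> by (intro mult_left_mono) (auto simp: power2_eq_square algebra_simps)
  then have 2: "2 * s\<^sup>2 * \<Lambda>\<^sup>2 + 2 * s\<^sup>2 * (l * (\<Lambda> + l)) \<le> 2 * s\<^sup>2 * (\<Lambda> + l)\<^sup>2"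
    by (simp add: algebra_simps)
  have "(dist y' z)\<^sup>2 \<le> (dist y z)\<^sup>2 - 2 * s * (h (Suc n) y' - h (Suc n) z)"
    using pv by (rule order_trans) simp
  also have "\<dots> \<le> (dist x z)\<^sup>2 - 2 * s * ((\<Sum>i=1..n. h i x) - (\<Sum>i=1..n. h i z)) + 2 * s\<^sup>2 * \<Lambda>\<^sup>2
      - 2 * s * (h (Suc n) y' - h (Suc n) z)"
    using Suc by (simp add: y_def \<Lambda>_def)
  also have "\<dots> \<le> (dist x z)\<^sup>2 - 2 * s * ((\<Sum>i=1..Suc n. h i x) - (\<Sum>i=1..Suc n. h i z))
      + 2 * s\<^sup>2 * (\<Lambda> + l)\<^sup>2"
    using 1 2 by (simp add: algebra_simps)
  finally show ?case using d by (simp add: y'_def \<Lambda>_def l_def add.commute)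
qed

text \<open>Steps of size \<open>\<tau> / n\<close> turn sums into \<open>\<tau>\<close> times
  averages, so a whole cycle behaves like one proximal step of size \<open>\<tau>\<close> for
  \<open>A\<close>, with an error that depends on \<open>\<tau>\<close> and \<open>K\<close> but not
  on \<open>n\<close>.\<close>

lemma averaged_prox_cycle:
  fixes h :: "nat \<Rightarrow> 'a::hadamard_space \<Rightarrow> real"
  assumes cb: "\<And>(x::'a) r. compact (cball x r)"
    and conv: "\<And>i. i \<ge> 1 \<Longrightarrow> geodesically_convex (\<lambda>x. ereal (h i x))"
    and lip: "\<And>i. i \<ge> 1 \<Longrightarrow> (L i)-lipschitz_on UNIV (h i)"
    and \<tau>: "\<tau> \<ge> 0" and n: "n > 0" and K: "(\<Sum>i=1..n. L i) / real n \<le> K"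
  defines "Q \<equiv> prox_cycle (\<tau> / real n) (\<lambda>i x. ereal (h i x)) n"
    and "A \<equiv> \<lambda>x. (\<Sum>i=1..n. h i x) / real n"
  shows averaged_prox_cycle_displacement: "dist x (Q x) \<le> \<tau> * K"
    and averaged_prox_cycle_variational:
      "(dist (Q x) z)\<^sup>2 \<le> (dist x z)\<^sup>2 - 2 * \<tau> * (A x - A z) + 2 * \<tau>\<^sup>2 * K\<^sup>2"
proof -
  define \<Lambda> where "\<Lambda> = (\<Sum>i=1..n. L i) / real n"
  have \<Lambda>: "0 \<le> \<Lambda>" "\<Lambda> \<le> K"
    unfolding \<Lambda>_def using K lipschitz_on_nonneg[OF lip] by (auto intro!: divide_nonneg_nonneg sum_nonneg)
  have *: "(\<Sum>i=1..n. L i) = real n * \<Lambda>" "(\<Sum>i=1..n. h i x) = real n * A x" for x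
    using n by (auto simp: \<Lambda>_def A_def)
  have "dist x (Q x) \<le> \<tau> / real n * (real n * \<Lambda>) \<and>
    (dist (Q x) z)\<^sup>2 \<le> (dist x z)\<^sup>2 - 2 * (\<tau> / real n) * (real n * A x - real n * A z)
      + 2 * (\<tau> / real n)\<^sup>2 * (real n * \<Lambda>)\<^sup>2"
    using prox_cycle_variational[where h = h and L = L and s = "\<tau> / real n" and n = n and x = x and z = z,
        OF cb conv lip] \<tau> unfolding *[symmetric] Q_def by simp
  then have 1: "dist x (Q x) \<le> \<tau> * \<Lambda>"
      "(dist (Q x) z)\<^sup>2 \<le> (dist x z)\<^sup>2 - 2 * \<tau> * (A x - A z) + 2 * (\<tau> * \<Lambda>)\<^sup>2"
    using n by (simp_all add: right_diff_distrib[symmetric] power_divide power_mult_distrib mult.assoc)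
  have 2: "\<tau> * \<Lambda> \<le> \<tau> * K" using \<tau> \<Lambda> by (intro mult_left_mono)
  then have "(\<tau> * \<Lambda>)\<^sup>2 \<le> (\<tau> * K)\<^sup>2" using \<tau> \<Lambda> by (intro power_mono) auto
  then show "(dist (Q x) z)\<^sup>2 \<le> (dist x z)\<^sup>2 - 2 * \<tau> * (A x - A z) + 2 * \<tau>\<^sup>2 * K\<^sup>2"
    using 1 by (simp add: power_mult_distrib)
  show "dist x (Q x) \<le> \<tau> * K" using 1 2 by simp
qed

section \<open>Comparison of trajectories and the exponential formula\<close>

lemma dist_funpow_le:
  fixes Q :: "'a::metric_space \<Rightarrow> 'a"
  assumes "\<And>x. dist x (Q x) \<le> r"
  shows "dist x ((Q ^^ k) x) \<le> real k * r"
proof (induction k)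
  case (Suc k)
  then show ?case
    using dist_triangle[of x "(Q ^^ Suc k) x" "(Q ^^ k) x"] assms[of "(Q ^^ k) x"]
    by (simp add: algebra_simps)
qed simp

text \<open>With \<open>u\<close> and \<open>v\<close> the current iterates, the inequality of
  \<open>Q\<close> at \<open>u\<close> is tested with \<open>v\<close> and that of \<open>R\<close>
  at \<open>v\<close> with \<open>Q u\<close>; their sum bounds the new squared distance by the old
  one plus function differences. Closeness of \<open>A\<close> and \<open>G\<close> is asked only on
  a ball that neither trajectory leaves within \<open>n\<close> steps.\<close>

lemma dist_iterates_le:
  fixes Q R :: "'a::metric_space \<Rightarrow> 'a"
  assumes Q: "\<And>x. dist x (Q x) \<le> \<tau> * K"
      "\<And>x z. (dist (Q x) z)\<^sup>2 \<le> (dist x z)\<^sup>2 - 2 * \<tau> * (A x - A z) + 2 * \<tau>\<^sup>2 * K\<^sup>2"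
    and R: "\<And>x. dist x (R x) \<le> \<tau> * K"
      "\<And>x z. (dist (R x) z)\<^sup>2 \<le> (dist x z)\<^sup>2 - 2 * \<tau> * (G x - G z) + 2 * \<tau>\<^sup>2 * K\<^sup>2"
    and G: "K-lipschitz_on UNIV G" and \<tau>: "\<tau> \<ge> 0"
    and close: "\<And>y. y \<in> cball x (real n * (\<tau> * K)) \<Longrightarrow> \<bar>A y - G y\<bar> \<le> \<epsilon>"
  shows "(dist ((Q ^^ n) x) ((R ^^ n) x))\<^sup>2 \<le> real n * (4 * \<tau> * \<epsilon> + 6 * \<tau>\<^sup>2 * K\<^sup>2)"
proof -
  have K: "K \<ge> 0" using G by (rule lipschitz_on_nonneg)
  have "k \<le> n \<Longrightarrow> (dist ((Q ^^ k) x) ((R ^^ k) x))\<^sup>2 \<le> real k * (4 * \<tau> * \<epsilon> + 6 * \<tau>\<^sup>2 * K\<^sup>2)" for k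
  proof (induction k)
    case (Suc k)
    define u where "u = (Q ^^ k) x"
    define v where "v = (R ^^ k) x"
    have "real k * (\<tau> * K) \<le> real n * (\<tau> * K)"
      using Suc.prems \<tau> K by (intro mult_right_mono) auto
    then have uv: "\<bar>A u - G u\<bar> \<le> \<epsilon>" "\<bar>A v - G v\<bar> \<le> \<epsilon>"
      using close dist_funpow_le[of Q "\<tau> * K" x k] dist_funpow_le[of R "\<tau> * K" x k] Q(1) R(1)
      by (auto simp: u_def v_def)
    have "\<bar>G u - G (Q u)\<bar> \<le> K * (\<tau> * K)"
      using lipschitz_onD[OF G, of u "Q u"] mult_left_mono[OF Q(1)[of u] K] by (simp add: dist_real_def)
    \<comment> \<open>Replacing \<open>A\<close> by \<open>G\<close> at \<open>u\<close> and
      \<open>v\<close> costs \<open>2 * \<epsilon>\<close>, and \<open>G u - G (Q u)\<close> costs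
      \<open>\<tau> * K\<^sup>2\<close>. Multiplied by \<open>2 * \<tau>\<close> and added to the
      two quadratic errors, this gives
      \<open>4 * \<tau> * \<epsilon> + 6 * \<tau>\<^sup>2 * K\<^sup>2\<close>.\<close>
    with uv have "- (A u - A v) - (G v - G (Q u)) \<le> 2 * \<epsilon> + K * (\<tau> * K)" by linarith
    then have 1: "2 * \<tau> * (- (A u - A v) - (G v - G (Q u))) \<le> 2 * \<tau> * (2 * \<epsilon> + K * (\<tau> * K))"
      using \<tau> by (intro mult_left_mono) auto
    have "(dist (Q u) (R v))\<^sup>2 \<le> (dist u v)\<^sup>2 - 2 * \<tau> * (A u - A v) - 2 * \<tau> * (G v - G (Q u)) + 4 * \<tau>\<^sup>2 * K\<^sup>2"
      using Q(2)[of u v] R(2)[of v "Q u"] by (simp add: dist_commute)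
    also have "\<dots> \<le> (dist u v)\<^sup>2 + (4 * \<tau> * \<epsilon> + 6 * \<tau>\<^sup>2 * K\<^sup>2)"
      using 1 by (simp add: algebra_simps power2_eq_square)
    finally show ?case using Suc by (simp add: u_def v_def algebra_simps)
  qed simp
  then show ?thesis by simp
qed

text \<open>Both \<open>m\<close> steps of size \<open>t / (m * n)\<close> and one step of size
  \<open>t / n\<close> are cycles of total step \<open>t / n\<close> for the same function.
  Comparing \<open>n\<close> rounds of each, with \<open>\<epsilon> = 0\<close>, gives a bound free
  of \<open>m\<close>.\<close>

lemma prox_iterates_refine:
  fixes h :: "'a::hadamard_space \<Rightarrow> real" and x :: 'a
  assumes cb: "\<And>(x::'a) r. compact (cball x r)"
    and conv: "geodesically_convex (\<lambda>x. ereal (h x))" and lip: "K-lipschitz_on UNIV h"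
    and t: "t \<ge> 0" and "m > 0" "n > 0"
  defines "w \<equiv> \<lambda>n. (prox (t / real n) (\<lambda>x. ereal (h x)) ^^ n) x"
  shows "(dist (w (m * n)) (w n))\<^sup>2 \<le> 6 * t\<^sup>2 * K\<^sup>2 / real n"
proof -
  let ?Q = "\<lambda>m. prox_cycle (t / real n / real m) (\<lambda>i x. ereal (h x)) m"
  have Q: "dist x (?Q m x) \<le> t / real n * K"
     "(dist (?Q m x) z)\<^sup>2 \<le> (dist x z)\<^sup>2 - 2 * (t / real n) * (h x - h z) + 2 * (t / real n)\<^sup>2 * K\<^sup>2"
    if "m > 0" for m x z
    using averaged_prox_cycle_displacement[OF cb conv lip, of "t / real n" m K x]
      averaged_prox_cycle_variational[OF cb conv lip, of "t / real n" m K x z] t that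
    by simp_all
  have "(dist ((?Q m ^^ n) x) ((?Q 1 ^^ n) x))\<^sup>2 \<le> real n * (4 * (t / real n) * 0 + 6 * (t / real n)\<^sup>2 * K\<^sup>2)"
    by (rule dist_iterates_le[of _ _ K h]) (use Q[OF \<open>m > 0\<close>] Q[of 1] lip t in auto)
  also have "?Q m ^^ n = prox (t / real (m * n)) (\<lambda>x. ereal (h x)) ^^ (m * n)"
    by (simp add: prox_cycle_const funpow_mult mult.commute)
  also have "?Q 1 = prox (t / real n) (\<lambda>x. ereal (h x))"
    by (simp add: prox_cycle_const)
  also have "real n * (4 * (t / real n) * 0 + 6 * (t / real n)\<^sup>2 * K\<^sup>2) = 6 * t\<^sup>2 * K\<^sup>2 / real n"
    using \<open>n > 0\<close> by (simp add: power2_eq_square field_simps)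
  finally show ?thesis unfolding w_def .
qed

text \<open>The iterates with \<open>m\<close> and with \<open>n\<close> steps are both close to
  those with \<open>m * n\<close> steps, so the sequence is Cauchy; by completeness the
  \<open>lim\<close> in \<open>gradient_flow\<close> is then a genuine limit.\<close>

lemma gradient_flow_limit:
  fixes h :: "'a::hadamard_space \<Rightarrow> real"
  assumes cb: "\<And>(x::'a) r. compact (cball x r)"
    and conv: "geodesically_convex (\<lambda>x. ereal (h x))" and lip: "K-lipschitz_on UNIV h"
    and t: "t > 0"
  shows "(\<lambda>n. (prox (t / real n) (\<lambda>x. ereal (h x)) ^^ n) x) \<longlonglongrightarrow> gradient_flow (\<lambda>x. ereal (h x)) t x"
proof -
  define w where "w = (\<lambda>n. (prox (t / real n) (\<lambda>x. ereal (h x)) ^^ n) x)"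
  have K: "K \<ge> 0" using lip by (rule lipschitz_on_nonneg)
  define C where "C = (\<lambda>n. sqrt (6 * t\<^sup>2 * K\<^sup>2 / real n))"
  have C: "dist (w (m * n)) (w n) \<le> C n" if "m > 0" "n > 0" for m n
    unfolding C_def w_def using prox_iterates_refine[OF cb conv lip, of t m n x] t that
    by (intro real_le_rsqrt) auto
  have "C \<longlonglongrightarrow> sqrt 0" unfolding C_def
    by (intro tendsto_real_sqrt tendsto_divide_0[OF tendsto_const] filterlim_at_top_imp_at_infinity
        filterlim_real_sequentially)
  then have C0: "C \<longlonglongrightarrow> 0" by simp
  have "Cauchy w"
  proof (rule metric_CauchyI)
    fix e :: real assume "e > 0"
    then obtain N where N: "\<And>n. n \<ge> N \<Longrightarrow> C n < e / 2"
      using order_tendstoD(2)[OF C0, of "e / 2"] by (auto simp: eventually_sequentially)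
    \<comment> \<open>Starting from \<open>Suc N\<close> keeps both step numbers positive, as the
      estimate by \<open>C\<close> requires.\<close>
    have "dist (w m) (w n) < e" if "m \<ge> Suc N" "n \<ge> Suc N" for m n
    proof -
      have "dist (w m) (w n) \<le> dist (w (n * m)) (w m) + dist (w (m * n)) (w n)"
        using dist_triangle2[of "w m" "w n" "w (m * n)"] by (simp add: mult.commute dist_commute)
      also have "\<dots> < e / 2 + e / 2"
        using C[of n m] C[of m n] N[of n] N[of m] that by linarith
      finally show ?thesis by simp
    qed
    then show "\<exists>M. \<forall>m\<ge>M. \<forall>n\<ge>M. dist (w m) (w n) < e" by blast
  qed
  then have "w \<longlonglongrightarrow> lim w" using Cauchy_convergent convergent_LIMSEQ_iff by blast
  then show ?thesis using t by (simp add: w_def gradient_flow_def)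
qed

section \<open>Convergence of cycles for a deterministic sequence of functions\<close>

lemma equi_lipschitz_eventually_uniform:
  fixes A :: "nat \<Rightarrow> 'a::metric_space \<Rightarrow> real"
  assumes C: "compact C" and A: "\<And>n. n > 0 \<Longrightarrow> K-lipschitz_on UNIV (A n)"
    and F: "K-lipschitz_on UNIV F"
    and lim: "\<And>x. x \<in> D \<Longrightarrow> (\<lambda>n. A n x) \<longlonglongrightarrow> F x" and D: "C \<subseteq> closure D" and "\<epsilon> > 0"
  shows "\<forall>\<^sub>F n in sequentially. \<forall>y\<in>C. \<bar>A n y - F y\<bar> \<le> \<epsilon>"
proof -
  have K: "K \<ge> 0" using F by (rule lipschitz_on_nonneg)
  \<comment> \<open>One third of \<open>\<epsilon>\<close> goes to the limit at net points and one
    third to each of the two Lipschitz errors; \<open>K + 1\<close> keeps the denominator positive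
    when \<open>K = 0\<close>.\<close>
  define \<delta> where "\<delta> = \<epsilon> / (3 * (K + 1))"
  have \<delta>: "\<delta> > 0" "K * \<delta> \<le> \<epsilon> / 3"
    using K \<open>\<epsilon> > 0\<close> by (auto simp: \<delta>_def field_simps)
  \<comment> \<open>The net is taken from \<open>D\<close>, possibly outside \<open>C\<close>, since
    the pointwise limits are known on \<open>D\<close>.\<close>
  have "C \<subseteq> (\<Union>y\<in>D. ball y \<delta>)"
  proof
    fix z assume "z \<in> C"
    then obtain y where "y \<in> D" "dist y z < \<delta>" using D \<delta>(1) closure_approachable by blast
    then show "z \<in> (\<Union>y\<in>D. ball y \<delta>)" by auto
  qed
  then obtain N where N: "N \<subseteq> D" "finite N" "C \<subseteq> (\<Union>y\<in>N. ball y \<delta>)"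
    using compactE_image[OF C, of D "\<lambda>y. ball y \<delta>"] by auto
  have "\<forall>\<^sub>F n in sequentially. \<forall>y\<in>N. \<bar>A n y - F y\<bar> < \<epsilon> / 3"
  proof (intro eventually_ball_finite ballI N)
    fix y assume "y \<in> N"
    then show "\<forall>\<^sub>F n in sequentially. \<bar>A n y - F y\<bar> < \<epsilon> / 3"
      using tendstoD[OF lim, of y "\<epsilon> / 3"] N \<open>\<epsilon> > 0\<close> by (auto simp: dist_real_def)
  qed
  then show ?thesis using eventually_gt_at_top[of 0]
  proof eventually_elim
    case (elim n)
    show ?case
    proof
      fix z assume "z \<in> C"
      then obtain y where y: "y \<in> N" "dist y z < \<delta>" using N by auto
      have "K * dist y z \<le> \<epsilon> / 3" using \<delta> mult_left_mono[of "dist y z" \<delta> K] y K by simp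
      moreover have "\<bar>A n y - A n z\<bar> \<le> K * dist y z" "\<bar>F y - F z\<bar> \<le> K * dist y z"
        using lipschitz_onD[OF A, of n y z] lipschitz_onD[OF F, of y z] elim(2)
        by (simp_all add: dist_real_def)
      ultimately show "\<bar>A n z - F z\<bar> \<le> \<epsilon>"
        using elim(1)[rule_format, OF y(1)] by linarith
    qed
  qed
qed

text \<open>This isolates what is later needed almost surely: convergence of the averages on a dense
  set and one bound \<open>K\<close> for the averaged Lipschitz constants. The \<open>n\<close>
  cycles are compared with \<open>n\<close> proximal steps of \<open>F\<close> of size
  \<open>t / n\<close>, which approximate the flow.\<close>

theorem prox_cycles_tendsto_gradient_flow:
  fixes g :: "nat \<Rightarrow> 'a::hadamard_space \<Rightarrow> real"
  assumes cb: "\<And>(x::'a) r. compact (cball x r)"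
    and conv: "\<And>i. i \<ge> 1 \<Longrightarrow> geodesically_convex (\<lambda>x. ereal (g i x))"
    and lip: "\<And>i. i \<ge> 1 \<Longrightarrow> (L i)-lipschitz_on UNIV (g i)"
    and K: "\<And>n. n > 0 \<Longrightarrow> (\<Sum>i=1..n. L i) / real n \<le> K"
    and F: "geodesically_convex (\<lambda>x. ereal (F x))" "K-lipschitz_on UNIV F"
    and lim: "\<And>x. x \<in> D \<Longrightarrow> (\<lambda>n. (\<Sum>i=1..n. g i x) / real n) \<longlonglongrightarrow> F x" and D: "closure D = UNIV"
    and t: "t \<ge> 0"
  shows "(\<lambda>n. (prox_cycle (t / (real n)\<^sup>2) (\<lambda>i x. ereal (g i x)) n ^^ n) x)
    \<longlonglongrightarrow> gradient_flow (\<lambda>x. ereal (F x)) t x"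
proof (cases "t = 0")
  case True
  have "prox_cycle 0 h n y = y" for h n and y :: 'a
    by (induction n) (auto simp: prox_cycle_Suc prox_def)
  then have "(prox_cycle 0 h n ^^ k) y = y" for h n k and y :: 'a
    by (induction k) auto
  then show ?thesis using True by (simp add: gradient_flow_def)
next
  case False
  with t have t: "t > 0" by simp
  define A where "A = (\<lambda>n x. (\<Sum>i=1..n. g i x) / real n)"
  define Q where "Q = (\<lambda>n. prox_cycle (t / (real n)\<^sup>2) (\<lambda>i x. ereal (g i x)) n)"
  define R where "R = (\<lambda>n. prox (t / real n) (\<lambda>x. ereal (F x)))"
  have A: "K-lipschitz_on UNIV (A n)" if "n > 0" for n
  proof (rule lipschitz_onI)
    show "dist (A n x) (A n y) \<le> K * dist x y" for x y
    proof -
      have "\<bar>(\<Sum>i=1..n. g i x) - (\<Sum>i=1..n. g i y)\<bar> \<le> (\<Sum>i=1..n. L i * dist x y)"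
        unfolding sum_subtractf[symmetric]
        using lipschitz_onD[OF lip, of _ x y]
        by (intro order_trans[OF sum_abs] sum_mono) (auto simp: dist_real_def)
      also have "\<dots> = (\<Sum>i=1..n. L i) * dist x y" by (simp add: sum_distrib_right)
      also have "\<dots> \<le> (K * real n) * dist x y"
        using K[OF that] that by (intro mult_right_mono) (auto simp: field_simps)
      finally show ?thesis
        using that by (simp add: A_def dist_real_def diff_divide_distrib[symmetric] field_simps)
    qed
    show "0 \<le> K" using F(2) by (rule lipschitz_on_nonneg)
  qed
  \<comment> \<open>The radius \<open>n * (\<tau> * K)\<close> from the comparison of trajectories
    is \<open>t * K\<close> here, so one compact ball serves all \<open>n\<close>.\<close>
  have bound: "(dist ((Q n ^^ n) x) ((R n ^^ n) x))\<^sup>2 \<le> 4 * t * \<epsilon> + 6 * t\<^sup>2 * K\<^sup>2 / real n"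
    if n: "n > 0" and close: "\<forall>y\<in>cball x (t * K). \<bar>A n y - F y\<bar> \<le> \<epsilon>" for n \<epsilon>
  proof -
    \<comment> \<open>Since \<open>t / (real n)\<^sup>2\<close> is \<open>?\<tau> / real n\<close>,
      one cycle advances by \<open>?\<tau>\<close> and \<open>n\<close> cycles by \<open>t\<close>.
      The proximal step of \<open>F\<close> is treated as a cycle of length one.\<close>
    let ?\<tau> = "t / real n"
    have Qn: "Q n = prox_cycle (?\<tau> / real n) (\<lambda>i x. ereal (g i x)) n"
      by (simp add: Q_def power2_eq_square)
    have Rn: "R n = prox_cycle (?\<tau> / real 1) (\<lambda>i x. ereal (F x)) 1"
      by (simp add: R_def prox_cycle_const)
    have "(dist ((Q n ^^ n) x) ((R n ^^ n) x))\<^sup>2 \<le> real n * (4 * ?\<tau> * \<epsilon> + 6 * ?\<tau>\<^sup>2 * K\<^sup>2)"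
    proof (rule dist_iterates_le[of _ _ K "A n" _ F])
      show "dist y (Q n y) \<le> ?\<tau> * K" for y
        unfolding Qn by (rule averaged_prox_cycle_displacement[OF cb conv lip]) (use t n K in auto)
      show "(dist (Q n y) z)\<^sup>2 \<le> (dist y z)\<^sup>2 - 2 * ?\<tau> * (A n y - A n z) + 2 * ?\<tau>\<^sup>2 * K\<^sup>2" for y z
        unfolding Qn A_def by (rule averaged_prox_cycle_variational[OF cb conv lip]) (use t n K in auto)
      show "dist y (R n y) \<le> ?\<tau> * K" for y
        unfolding Rn by (rule averaged_prox_cycle_displacement[OF cb F(1) F(2)]) (use t n in auto)
      show "(dist (R n y) z)\<^sup>2 \<le> (dist y z)\<^sup>2 - 2 * ?\<tau> * (F y - F z) + 2 * ?\<tau>\<^sup>2 * K\<^sup>2" for y z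
        using averaged_prox_cycle_variational[OF cb F(1) F(2), of ?\<tau> 1 K y z] t n
        unfolding Rn by simp
    qed (use F t n close in auto)
    also have "\<dots> = 4 * t * \<epsilon> + 6 * t\<^sup>2 * K\<^sup>2 / real n"
      using n by (simp add: power2_eq_square field_simps)
    finally show ?thesis .
  qed
  have "(\<lambda>n. (dist ((Q n ^^ n) x) ((R n ^^ n) x))\<^sup>2) \<longlonglongrightarrow> 0"
  proof (rule order_tendstoI)
    fix e :: real assume "0 < e"
    \<comment> \<open>Half of \<open>e\<close> is reserved for \<open>4 * t * \<epsilon>\<close>,
      the other half for the error of order \<open>1 / n\<close>.\<close>
    define \<epsilon> where "\<epsilon> = e / (8 * t)"
    have "\<epsilon> > 0" "4 * t * \<epsilon> = e / 2" using \<open>0 < e\<close> t by (auto simp: \<epsilon>_def)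
    have "(\<lambda>n. 6 * t\<^sup>2 * K\<^sup>2 / real n) \<longlonglongrightarrow> 0"
      by (intro tendsto_divide_0[OF tendsto_const] filterlim_at_top_imp_at_infinity
        filterlim_real_sequentially)
    then have "\<forall>\<^sub>F n in sequentially. 6 * t\<^sup>2 * K\<^sup>2 / real n < e / 2"
      using \<open>0 < e\<close> by (intro order_tendstoD) auto
    moreover have "\<forall>\<^sub>F n in sequentially. \<forall>y\<in>cball x (t * K). \<bar>A n y - F y\<bar> \<le> \<epsilon>"
      by (rule equi_lipschitz_eventually_uniform[OF cb A F(2), where D = D])
        (use lim D \<open>\<epsilon> > 0\<close> in \<open>auto simp: A_def\<close>)
    ultimately show "\<forall>\<^sub>F n in sequentially. (dist ((Q n ^^ n) x) ((R n ^^ n) x))\<^sup>2 < e"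
      using eventually_gt_at_top[of 0]
    proof eventually_elim
      case (elim n)
      then show ?case using bound[of n \<epsilon>] \<open>4 * t * \<epsilon> = e / 2\<close> by simp
    qed
  next
    fix e :: real assume "e < 0"
    then show "\<forall>\<^sub>F n in sequentially. e < (dist ((Q n ^^ n) x) ((R n ^^ n) x))\<^sup>2"
      by (intro always_eventually allI) (rule less_le_trans[OF _ zero_le_power2])
  qed
  from tendsto_real_sqrt[OF this] have "(\<lambda>n. dist ((Q n ^^ n) x) ((R n ^^ n) x)) \<longlonglongrightarrow> 0" by simp
  moreover have "(\<lambda>n. dist ((R n ^^ n) x) (gradient_flow (\<lambda>x. ereal (F x)) t x)) \<longlonglongrightarrow> 0"
    unfolding R_def tendsto_dist_iff[symmetric] by (rule gradient_flow_limit[OF cb F t])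
  ultimately have lim0: "(\<lambda>n. dist ((Q n ^^ n) x) ((R n ^^ n) x) +
      dist ((R n ^^ n) x) (gradient_flow (\<lambda>x. ereal (F x)) t x)) \<longlonglongrightarrow> 0"
    by (rule tendsto_add_zero)
  have "(\<lambda>n. dist ((Q n ^^ n) x) (gradient_flow (\<lambda>x. ereal (F x)) t x)) \<longlonglongrightarrow> 0"
    by (rule tendsto_sandwich[OF _ _ tendsto_const lim0]) (simp_all add: dist_triangle)
  then show ?thesis unfolding Q_def by (subst tendsto_dist_iff)
qed

section \<open>The strong law of large numbers\<close>

context sequence_space
begin

text \<open>The empty sum is included, so the maximum is nonnegative; the recursion under prepending
  a term and the later domination argument rest on this.\<close>

definition max_partial_sum :: "('a \<Rightarrow> real) \<Rightarrow> nat \<Rightarrow> (nat \<Rightarrow> 'a) \<Rightarrow> real" where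
  "max_partial_sum \<phi> n \<omega> = Max ((\<lambda>k. \<Sum>i<k. \<phi> (\<omega> i)) ` {..n})"

lemma max_partial_sum_0 [simp]: "max_partial_sum \<phi> 0 \<omega> = 0"
  by (simp add: max_partial_sum_def)

lemma max_partial_sum_Suc:
  "max_partial_sum \<phi> (Suc n) \<omega> = max (\<Sum>i<Suc n. \<phi> (\<omega> i)) (max_partial_sum \<phi> n \<omega>)"
  unfolding max_partial_sum_def atMost_Suc image_insert by (subst Max_insert) auto

lemma max_partial_sum_mono: "m \<le> n \<Longrightarrow> max_partial_sum \<phi> m \<omega> \<le> max_partial_sum \<phi> n \<omega>"
  unfolding max_partial_sum_def by (intro Max_mono) auto

lemma max_partial_sum_nonneg: "0 \<le> max_partial_sum \<phi> n \<omega>"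
  using max_partial_sum_mono[of 0 n] by simp

lemma partial_sum_le_max: "(\<Sum>i<n. \<phi> (\<omega> i)) \<le> max_partial_sum \<phi> n \<omega>"
  unfolding max_partial_sum_def by (intro Max_ge) auto

text \<open>\<open>case_nat s \<omega>\<close> is \<open>\<omega>\<close> with \<open>s\<close> put
  in front. Nonempty partial sums become \<open>\<phi> s\<close> plus a partial sum of
  \<open>\<omega>\<close>; the empty one gives the 0 in the maximum.\<close>

lemma max_partial_sum_case_nat:
  "max_partial_sum \<phi> (Suc n) (case_nat s \<omega>) = max 0 (\<phi> s + max_partial_sum \<phi> n \<omega>)"
proof (induction n)
  case 0
  show ?case by (simp add: max_partial_sum_Suc max.commute)
next
  case (Suc n)
  have "(\<Sum>i<Suc (Suc n). \<phi> (case_nat s \<omega> i)) = \<phi> s + (\<Sum>i<Suc n. \<phi> (\<omega> i))"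
    by (simp add: sum.lessThan_Suc_shift del: sum.lessThan_Suc)
  then show ?case
    unfolding max_partial_sum_Suc[of \<phi> "Suc n"] max_partial_sum_Suc[of \<phi> n \<omega>] Suc
    by (simp add: max_def del: sum.lessThan_Suc)
qed

lemma measurable_max_partial_sum [measurable]:
  assumes [measurable]: "\<phi> \<in> borel_measurable M"
  shows "max_partial_sum \<phi> n \<in> borel_measurable S"
proof (induction n)
  case 0
  show ?case by (simp add: max_partial_sum_0[abs_def] cong: measurable_cong)
next
  case (Suc n)
  note [measurable] = Suc
  show ?case unfolding max_partial_sum_Suc[abs_def] by measurable
qed

lemma integrable_coordinate:
  fixes \<phi> :: "'a \<Rightarrow> real"
  assumes "integrable M \<phi>"
  shows "integrable S (\<lambda>\<omega>. \<phi> (\<omega> i))"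
proof -
  have "integrable (distr S M (\<lambda>\<omega>. \<omega> i)) \<phi>"
    using assms by (simp add: PiM_component)
  then show ?thesis by (subst (asm) integrable_distr_eq) (use assms in auto)
qed

lemma integrable_max_partial_sum:
  assumes "integrable M \<phi>"
  shows "integrable S (max_partial_sum \<phi> n)"
proof (induction n)
  case (Suc n)
  then show ?case unfolding max_partial_sum_Suc[abs_def]
    using integrable_coordinate[OF assms] by (intro integrable_max Bochner_Integration.integrable_sum) auto
qed (simp add: max_partial_sum_0[abs_def])

text \<open>Natural thresholds express unboundedness by countably many conditions, which makes the
  event measurable.\<close>

definition sums_unbounded :: "('a \<Rightarrow> real) \<Rightarrow> (nat \<Rightarrow> 'a) \<Rightarrow> bool" where
  "sums_unbounded \<phi> \<omega> \<longleftrightarrow> (\<forall>c::nat. \<exists>n. real c < max_partial_sum \<phi> n \<omega>)"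

text \<open>A term in front changes the running maxima, up to an index shift, by at most
  \<open>\<bar>\<phi> s\<bar>\<close>.\<close>

lemma sums_unbounded_case_nat: "sums_unbounded \<phi> (case_nat s \<omega>) \<longleftrightarrow> sums_unbounded \<phi> \<omega>"
proof
  assume *: "sums_unbounded \<phi> (case_nat s \<omega>)"
  show "sums_unbounded \<phi> \<omega>" unfolding sums_unbounded_def
  proof
    fix c :: nat
    obtain d :: nat where d: "real c + \<bar>\<phi> s\<bar> < real d" using reals_Archimedean2 by blast
    obtain n where "real d < max_partial_sum \<phi> n (case_nat s \<omega>)" using * sums_unbounded_def by blast
    then have "real d < max 0 (\<phi> s + max_partial_sum \<phi> n \<omega>)"
      using max_partial_sum_mono[of n "Suc n" \<phi> "case_nat s \<omega>"] by (simp add: max_partial_sum_case_nat)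
    with d show "\<exists>n. real c < max_partial_sum \<phi> n \<omega>" by (intro exI[of _ n]) auto
  qed
next
  assume *: "sums_unbounded \<phi> \<omega>"
  show "sums_unbounded \<phi> (case_nat s \<omega>)" unfolding sums_unbounded_def
  proof
    fix c :: nat
    obtain d :: nat where d: "real c + \<bar>\<phi> s\<bar> < real d" using reals_Archimedean2 by blast
    obtain n where "real d < max_partial_sum \<phi> n \<omega>" using * sums_unbounded_def by blast
    with d show "\<exists>n. real c < max_partial_sum \<phi> n (case_nat s \<omega>)"
      by (intro exI[of _ "Suc n"]) (auto simp: max_partial_sum_case_nat)
  qed
qed

text \<open>Let \<open>A\<close> be the shift-invariant event that the partial sums are unbounded and \<open>M\<^sub>n\<close> their running
  maximum.  Since \<open>M\<^sub>n\<close> is increasing in \<open>n\<close> and \<open>M\<^sub>n\<^sub>+\<^sub>1 = max 0 (\<phi> + M\<^sub>n \<circ> shift)\<close>, the variable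
  \<open>max (- M\<^sub>n \<circ> shift) \<phi>\<close> has nonnegative integral over \<open>A\<close>; letting \<open>n\<close> tend to infinity gives
  \<open>P(A) E \<phi> \<ge> 0\<close>.\<close>

lemma AE_not_sums_unbounded:
  fixes \<phi> :: "'a \<Rightarrow> real"
  assumes int: "integrable M \<phi>" and neg: "(\<integral>x. \<phi> x \<partial>M) < 0"
  shows "AE \<omega> in S. \<not> sums_unbounded \<phi> \<omega>"
proof -
  have [measurable]: "\<phi> \<in> borel_measurable M" using int by auto
  interpret MS: pair_prob_space M S ..
  define A where "A = {\<omega> \<in> space S. sums_unbounded \<phi> \<omega>}"
  have A[measurable]: "A \<in> sets S" unfolding A_def sums_unbounded_def by measurable
  \<comment> \<open>On the event, this is the increase from the maximum of \<open>\<omega>\<close>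
    over \<open>n\<close> terms to that of \<open>case_nat s \<omega>\<close> over
    \<open>Suc n\<close> terms.\<close>
  let ?Z = "\<lambda>n (s, \<omega>). indicator A \<omega> * max (- max_partial_sum \<phi> n \<omega>) (\<phi> s)"
  have indA: "indicator A (case_nat s \<omega>) = (indicator A \<omega> :: real)"
    if "s \<in> space M" "\<omega> \<in> space S" for s \<omega>
    using that by (auto simp: A_def indicator_def sums_unbounded_case_nat space_PiM PiE_iff split: nat.split)
  \<comment> \<open>Prepending an independent coordinate preserves the product measure, so integrals
    over \<open>S\<close> can be computed on \<open>M \<Otimes>\<^sub>M S\<close>.\<close>
  have int_shift: "integrable (M \<Otimes>\<^sub>M S) (\<lambda>(s, \<omega>). g (case_nat s \<omega>))"
      "(\<integral>(s, \<omega>). g (case_nat s \<omega>) \<partial>(M \<Otimes>\<^sub>M S)) = (\<integral>\<omega>. g \<omega> \<partial>S)"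
    if "integrable S g" for g :: "(nat \<Rightarrow> 'a) \<Rightarrow> real"
  proof -
    have [measurable]: "g \<in> borel_measurable S" using that by auto
    have m: "(\<lambda>(s, \<omega>). case_nat s \<omega>) \<in> measurable (M \<Otimes>\<^sub>M S) S" by measurable
    have "integrable (distr (M \<Otimes>\<^sub>M S) S (\<lambda>(s, \<omega>). case_nat s \<omega>)) g"
      using that by (simp add: PiM_iter)
    then show "integrable (M \<Otimes>\<^sub>M S) (\<lambda>(s, \<omega>). g (case_nat s \<omega>))"
      by (subst (asm) integrable_distr_eq[OF m]) (auto simp: split_beta')
    have "(\<integral>\<omega>. g \<omega> \<partial>S) = (\<integral>\<omega>. g \<omega> \<partial>(distr (M \<Otimes>\<^sub>M S) S (\<lambda>(s, \<omega>). case_nat s \<omega>)))"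
      by (simp add: PiM_iter)
    also have "\<dots> = (\<integral>(s, \<omega>). g (case_nat s \<omega>) \<partial>(M \<Otimes>\<^sub>M S))"
      by (subst integral_distr[OF m]) (auto simp: split_beta')
    finally show "(\<integral>(s, \<omega>). g (case_nat s \<omega>) \<partial>(M \<Otimes>\<^sub>M S)) = (\<integral>\<omega>. g \<omega> \<partial>S)" ..
  qed
  have int_snd: "integrable (M \<Otimes>\<^sub>M S) (\<lambda>(s, \<omega>). g \<omega>)"
      "(\<integral>(s, \<omega>). g \<omega> \<partial>(M \<Otimes>\<^sub>M S)) = (\<integral>\<omega>. g \<omega> \<partial>S)"
    if "integrable S g" for g :: "(nat \<Rightarrow> 'a) \<Rightarrow> real"
  proof -
    have [measurable]: "g \<in> borel_measurable S" using that by auto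
    show 1: "integrable (M \<Otimes>\<^sub>M S) (\<lambda>(s, \<omega>). g \<omega>)"
      using that by (intro MS.Fubini_integrable) (auto simp: M.prob_space)
    show "(\<integral>(s, \<omega>). g \<omega> \<partial>(M \<Otimes>\<^sub>M S)) = (\<integral>\<omega>. g \<omega> \<partial>S)"
      using MS.integral_fst'[OF 1] by (simp add: M.prob_space)
  qed
  have AM: "integrable S (\<lambda>\<omega>. indicator A \<omega> * max_partial_sum \<phi> n \<omega>)" for n
    using integrable_max_partial_sum[OF int] A
    by (intro integrable_real_mult_indicator[of A S, unfolded mult.commute[of _ "indicator _ _"]]) auto
  have max_shift: "max 0 (a + b) - b = max (- b) a" for a b :: real by auto
  have abs_max: "\<bar>max (- b) a\<bar> \<le> \<bar>a\<bar>" if "0 \<le> b" for a b :: real using that by auto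
  \<comment> \<open>Monotonicity in \<open>n\<close> makes a difference of integrals over
    \<open>S\<close> nonnegative. The larger one is rewritten by prepending, the smaller through the
    second coordinate, and invariance of \<open>A\<close> gives both the same indicator.\<close>
  have nonneg: "0 \<le> (\<integral>x. ?Z n x \<partial>(M \<Otimes>\<^sub>M S))" for n
  proof -
    have "0 \<le> (\<integral>\<omega>. indicator A \<omega> * max_partial_sum \<phi> (Suc n) \<omega> \<partial>S)
        - (\<integral>\<omega>. indicator A \<omega> * max_partial_sum \<phi> n \<omega> \<partial>S)"
      using AM by (auto intro!: integral_mono mult_left_mono max_partial_sum_mono)
    also have "\<dots> = (\<integral>(s, \<omega>). indicator A (case_nat s \<omega>) * max_partial_sum \<phi> (Suc n) (case_nat s \<omega>) \<partial>(M \<Otimes>\<^sub>M S))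
       - (\<integral>(s, \<omega>). indicator A \<omega> * max_partial_sum \<phi> n \<omega> \<partial>(M \<Otimes>\<^sub>M S))"
      using int_shift(2)[OF AM] int_snd(2)[OF AM] by simp
    also have "\<dots> = (\<integral>x. (case x of (s, \<omega>) \<Rightarrow> indicator A (case_nat s \<omega>) * max_partial_sum \<phi> (Suc n) (case_nat s \<omega>))
       - (case x of (s, \<omega>) \<Rightarrow> indicator A \<omega> * max_partial_sum \<phi> n \<omega>) \<partial>(M \<Otimes>\<^sub>M S))"
      using int_shift(1)[OF AM] int_snd(1)[OF AM] by (intro Bochner_Integration.integral_diff[symmetric])
    also have "\<dots> = (\<integral>x. ?Z n x \<partial>(M \<Otimes>\<^sub>M S))"
      by (intro Bochner_Integration.integral_cong refl)
        (auto simp: space_pair_measure indA max_partial_sum_case_nat right_diff_distrib[symmetric] max_shift)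
    finally show ?thesis .
  qed
  have indA_int: "integrable S (indicat_real A)"
    by (intro integrable_real_indicator) (auto simp: P.emeasure_eq_measure)
  have int_fst: "integrable (M \<Otimes>\<^sub>M S) (\<lambda>(s, \<omega>). indicator A \<omega> * \<phi> s)"
      "integrable (M \<Otimes>\<^sub>M S) (\<lambda>(s, \<omega>). \<bar>\<phi> s\<bar>)"
    using int indA_int by (auto intro!: MS.Fubini_integrable simp: abs_mult P.prob_space)
  \<comment> \<open>Nonnegativity of the maxima gives the dominating function
    \<open>\<bar>\<phi> s\<bar>\<close>; on \<open>A\<close> they eventually exceed it, so the
    integrand equals \<open>\<phi> s\<close> from some \<open>n\<close> on.\<close>
  have "(\<lambda>n. \<integral>x. ?Z n x \<partial>(M \<Otimes>\<^sub>M S)) \<longlonglongrightarrow> (\<integral>(s, \<omega>). indicator A \<omega> * \<phi> s \<partial>(M \<Otimes>\<^sub>M S))"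
  proof (rule integral_dominated_convergence[OF _ _ int_fst(2)])
    show "AE x in M \<Otimes>\<^sub>M S. (\<lambda>n. ?Z n x) \<longlonglongrightarrow> (case x of (s, \<omega>) \<Rightarrow> indicator A \<omega> * \<phi> s)"
    proof (intro AE_I2, clarify)
      fix s \<omega>
      show "(\<lambda>n. indicator A \<omega> * max (- max_partial_sum \<phi> n \<omega>) (\<phi> s)) \<longlonglongrightarrow> indicator A \<omega> * \<phi> s"
      proof (cases "\<omega> \<in> A")
        case True
        obtain c :: nat where "\<bar>\<phi> s\<bar> < real c" using reals_Archimedean2 by blast
        moreover obtain N where "real c < max_partial_sum \<phi> N \<omega>"
          using True by (auto simp: A_def sums_unbounded_def)
        ultimately have "max (- max_partial_sum \<phi> n \<omega>) (\<phi> s) = \<phi> s" if "n \<ge> N" for n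
          using max_partial_sum_mono[OF that, of \<phi> \<omega>] by auto
        then show ?thesis
          by (intro tendsto_eventually) (auto simp: eventually_sequentially)
      qed simp
    qed
    show "AE x in M \<Otimes>\<^sub>M S. norm (?Z n x) \<le> (case x of (s, \<omega>) \<Rightarrow> \<bar>\<phi> s\<bar>)" for n
      using max_partial_sum_nonneg[of \<phi> n] by (auto intro!: AE_I2 abs_max simp: indicator_def)
  qed measurable
  then have "0 \<le> (\<integral>(s, \<omega>). indicator A \<omega> * \<phi> s \<partial>(M \<Otimes>\<^sub>M S))"
    using nonneg by (intro tendsto_lowerbound[of _ _ sequentially 0]) auto
  \<comment> \<open>Fubini separates the event from the first coordinate: the limit is
    \<open>P.prob A\<close> times the negative mean, so nonnegativity forces
    \<open>P.prob A = 0\<close>.\<close>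
  also have "\<dots> = (\<integral>s. (\<integral>\<omega>. indicator A \<omega> * \<phi> s \<partial>S) \<partial>M)"
    using MS.integral_fst'[OF int_fst(1)] by simp
  also have "\<dots> = P.prob A * (\<integral>s. \<phi> s \<partial>M)" by simp
  finally have "P.prob A = 0" using neg measure_nonneg[of S A] by (simp add: zero_le_mult_iff)
  then have "AE \<omega> in S. \<omega> \<notin> A"
    by (intro AE_not_in) (auto simp: null_sets_def P.emeasure_eq_measure)
  then show ?thesis using AE_space by eventually_elim (auto simp: A_def)
qed

text \<open>Subtracting slightly more than the mean makes the mean negative, so the partial sums are
  almost surely bounded above, and a bound divided by \<open>n\<close> vanishes. Excesses
  \<open>1 / Suc k\<close> keep the exceptional events countable in number.\<close>

lemma AE_limsup_average_le:
  fixes \<phi> :: "'a \<Rightarrow> real"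
  assumes int: "integrable M \<phi>"
  shows "AE \<omega> in S. \<forall>e>0. \<forall>\<^sub>F n in sequentially. (\<Sum>i<n. \<phi> (\<omega> i)) / real n < (\<integral>x. \<phi> x \<partial>M) + e"
proof -
  define m where "m = (\<integral>x. \<phi> x \<partial>M)"
  have "AE \<omega> in S. \<not> sums_unbounded (\<lambda>x. \<phi> x - (m + 1 / real (Suc k))) \<omega>" for k
    using int by (intro AE_not_sums_unbounded) (auto simp: M.prob_space m_def[symmetric])
  then have "AE \<omega> in S. \<forall>k. \<not> sums_unbounded (\<lambda>x. \<phi> x - (m + 1 / real (Suc k))) \<omega>"
    by (simp add: AE_all_countable)
  then show ?thesis
  proof eventually_elim
    case (elim \<omega>)
    show ?case
    proof (intro allI impI)
      fix e :: real assume "e > 0"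
      then obtain k where k: "1 / real (Suc k) < e / 2"
        using nat_approx_posE[of "e / 2"] by (auto simp: divide_simps)
      obtain c :: nat where c: "max_partial_sum (\<lambda>x. \<phi> x - (m + 1 / real (Suc k))) n \<omega> \<le> real c" for n
        using elim unfolding sums_unbounded_def by (meson not_less)
      \<comment> \<open>Half of \<open>e\<close> absorbs the excess \<open>1 / Suc k\<close>; beyond
        this \<open>N\<close> the other half absorbs \<open>c / n\<close>.\<close>
      obtain N :: nat where N: "real c / (e / 2) < real N" using reals_Archimedean2 by blast
      show "\<forall>\<^sub>F n in sequentially. (\<Sum>i<n. \<phi> (\<omega> i)) / real n < (\<integral>x. \<phi> x \<partial>M) + e"
        using eventually_gt_at_top[of N]
      proof eventually_elim
        case (elim n)
        have "(\<Sum>i<n. \<phi> (\<omega> i)) - real n * (m + 1 / real (Suc k)) \<le> real c"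
          using partial_sum_le_max[of "\<lambda>x. \<phi> x - (m + 1 / real (Suc k))" \<omega> n] c[of n]
          by (simp add: sum_subtractf)
        moreover have "real n * (1 / real (Suc k)) \<le> real n * (e / 2)"
          using k by (intro mult_left_mono) auto
        moreover have "real c < real N * (e / 2)"
          using N \<open>e > 0\<close> by (simp add: pos_divide_less_eq)
        moreover have "real N * (e / 2) \<le> real n * (e / 2)"
          using elim \<open>e > 0\<close> by (intro mult_right_mono) auto
        ultimately have "(\<Sum>i<n. \<phi> (\<omega> i)) < real n * (m + e)"
          unfolding distrib_left by linarith
        then show ?case using elim by (simp add: field_simps m_def[symmetric])
      qed
    qed
  qed
qed

text \<open>The upper estimate for \<open>- \<phi>\<close> is the lower estimate for
  \<open>\<phi>\<close>.\<close>

theorem strong_law_of_large_numbers: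
  fixes \<phi> :: "'a \<Rightarrow> real"
  assumes int: "integrable M \<phi>"
  shows "AE \<omega> in S. (\<lambda>n. (\<Sum>i<n. \<phi> (\<omega> i)) / real n) \<longlonglongrightarrow> (\<integral>x. \<phi> x \<partial>M)"
  using AE_limsup_average_le[OF int] AE_limsup_average_le[of "\<lambda>x. - \<phi> x", OF integrable_minus[OF int]]
proof eventually_elim
  case (elim \<omega>)
  show ?case
  proof (rule order_tendstoI)
    fix a assume "(\<integral>x. \<phi> x \<partial>M) < a"
    then show "\<forall>\<^sub>F n in sequentially. (\<Sum>i<n. \<phi> (\<omega> i)) / real n < a"
      using elim(1)[rule_format, of "a - (\<integral>x. \<phi> x \<partial>M)"] by simp
  next
    fix a assume "a < (\<integral>x. \<phi> x \<partial>M)"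
    then show "\<forall>\<^sub>F n in sequentially. a < (\<Sum>i<n. \<phi> (\<omega> i)) / real n"
      using elim(2)[rule_format, of "(\<integral>x. \<phi> x \<partial>M) - a"] by (simp add: sum_negf)
  qed
qed

end

text \<open>Independence and the common law make the law of the whole sequence a product measure,
  from which the almost sure statement is pulled back.\<close>

theorem (in prob_space) iid_strong_law_of_large_numbers:
  fixes \<phi> :: "'b \<Rightarrow> real"
  assumes indep: "indep_vars (\<lambda>_. N) X {1..}"
    and distr: "\<And>i. 1 \<le> i \<Longrightarrow> distr M N (X i) = N" and N: "prob_space N"
    and int: "integrable N \<phi>"
  shows "AE \<omega> in M. (\<lambda>n. (\<Sum>i=1..n. \<phi> (X i \<omega>)) / real n) \<longlonglongrightarrow> (\<integral>x. \<phi> x \<partial>N)"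
proof -
  interpret N: prob_space N by fact
  interpret seq: sequence_space N ..
  have X: "X i \<in> measurable M N" if "i \<ge> 1" for i
    using indep that by (auto simp: indep_vars_def)
  define Y where "Y = (\<lambda>\<omega>. \<lambda>i\<in>{1..}. X i \<omega>)"
  have Y: "Y \<in> measurable M (Pi\<^sub>M {1..} (\<lambda>_. N))"
    unfolding Y_def using X by (intro measurable_restrict) auto
  \<comment> \<open>The variables are numbered from 1 and the coordinates of the sequence space from
    0; \<open>sh\<close> renumbers, and the product measure is carried to the product
    measure.\<close>
  define sh where "sh = (\<lambda>(y :: nat \<Rightarrow> 'b). \<lambda>n\<in>UNIV. y (Suc n))"
  have sh: "sh \<in> measurable (Pi\<^sub>M {1..} (\<lambda>_. N)) (Pi\<^sub>M UNIV (\<lambda>_. N))"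
    unfolding sh_def by (intro measurable_restrict measurable_component_singleton) auto
  have "distr M (Pi\<^sub>M {1..} (\<lambda>_. N)) Y = (\<Pi>\<^sub>M i\<in>{1..}. distr M N (X i))"
    using indep indep_vars_iff_distr_eq_PiM'[of "{1..}" X "\<lambda>_. N"] X unfolding Y_def by auto
  also have "\<dots> = Pi\<^sub>M {1..} (\<lambda>_. N)"
    using distr by (intro PiM_cong) auto
  finally have Yd: "distr M (Pi\<^sub>M {1..} (\<lambda>_. N)) Y = Pi\<^sub>M {1..} (\<lambda>_. N)" .
  have "distr M (Pi\<^sub>M UNIV (\<lambda>_. N)) (sh \<circ> Y) = distr (Pi\<^sub>M {1..} (\<lambda>_. N)) (Pi\<^sub>M UNIV (\<lambda>_. N)) sh"
    using distr_distr[OF sh Y] Yd by simp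
  also have "\<dots> = Pi\<^sub>M UNIV (\<lambda>_. N)"
    unfolding sh_def using distr_PiM_reindex[of "{1..}" "\<lambda>_. N" Suc UNIV] N by auto
  finally have d: "distr M (Pi\<^sub>M UNIV (\<lambda>_. N)) (sh \<circ> Y) = Pi\<^sub>M UNIV (\<lambda>_. N)" .
  have "AE y in distr M (Pi\<^sub>M UNIV (\<lambda>_. N)) (sh \<circ> Y).
      (\<lambda>n. (\<Sum>i<n. \<phi> (y i)) / real n) \<longlonglongrightarrow> (\<integral>x. \<phi> x \<partial>N)"
    unfolding d by (rule seq.strong_law_of_large_numbers[OF int])
  then have "AE \<omega> in M. (\<lambda>n. (\<Sum>i<n. \<phi> ((sh \<circ> Y) \<omega> i)) / real n) \<longlonglongrightarrow> (\<integral>x. \<phi> x \<partial>N)"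
    by (rule AE_distrD[OF measurable_comp[OF Y sh]])
  moreover have "(\<Sum>i<n. \<phi> ((sh \<circ> Y) \<omega> i)) = (\<Sum>i=1..n. \<phi> (X i \<omega>))" for n \<omega>
    by (rule sum.reindex_bij_witness[of _ "\<lambda>i. i - 1" Suc]) (auto simp: sh_def Y_def)
  ultimately show ?thesis by simp
qed

section \<open>Random cycles\<close>

lemma prox_cycle_cong:
  assumes "\<And>i. 1 \<le> i \<Longrightarrow> h i = h' i"
  shows "prox_cycle s h n = prox_cycle s h' n"
  unfolding prox_cycle_def by (intro ext fold_cong refl) (auto simp: assms)

text \<open>The dense set collects finite nets of mesh \<open>1 / Suc k\<close> of the balls of
  integer radius; it provides the countably many points for the strong law.\<close>

lemma separable_if_compact_cballs:
  fixes u :: "'a::metric_space"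
  assumes cb: "\<And>r. compact (cball u r)"
  obtains D :: "'a set" where "countable D" "closure D = UNIV"
proof -
  have "\<exists>N. finite N \<and> cball u (real n) \<subseteq> (\<Union>y\<in>N. ball y (1 / real (Suc k)))" for n k
  proof -
    have "1 / real (Suc k) > 0" by simp
    with cb[of "real n"] show ?thesis unfolding compact_eq_totally_bounded by blast
  qed
  then obtain N where N: "\<And>n k. finite (N n k)"
    "\<And>n k. cball u (real n) \<subseteq> (\<Union>y\<in>N n k. ball y (1 / real (Suc k)))" by metis
  have "x \<in> closure (\<Union>n k. N n k)" for x
    unfolding closure_approachable
  proof (intro allI impI)
    fix e :: real assume "e > 0"
    then obtain k where k: "1 / real (Suc k) < e" using nat_approx_posE by blast
    obtain n :: nat where "dist u x \<le> real n" using real_arch_simple by blast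
    then obtain y where "y \<in> N n k" "dist y x < 1 / real (Suc k)" using N(2)[of n k] by force
    with k show "\<exists>y\<in>\<Union>n k. N n k. dist y x < e" by force
  qed
  then show thesis using N(1) by (intro that[of "\<Union>n k. N n k"]) (auto intro!: countable_UN intro: countable_finite)
qed

section \<open>The integrand as a real function, and its integral\<close>

lemma L1_Lipschitz_real:
  assumes "L1_Lipschitz M f"
  obtains L where "integrable M L" "\<And>e. e \<in> space M \<Longrightarrow> 0 < L e"
    "\<And>e x. e \<in> space M \<Longrightarrow> f e x = ereal (real_of_ereal (f e x))"
    "\<And>e. e \<in> space M \<Longrightarrow> (L e)-lipschitz_on UNIV (\<lambda>x. real_of_ereal (f e x))"
proof -
  obtain L where L: "integrable M L" "\<And>e. e \<in> space M \<Longrightarrow> 0 < L e"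
    "\<And>e x y. e \<in> space M \<Longrightarrow> \<bar>f e x - f e y\<bar> \<le> ereal (L e * dist x y)"
    using assms unfolding L1_Lipschitz_def by blast
  \<comment> \<open>At \<open>y = x\<close> the right side is 0, while an infinite value subtracted
    from itself has absolute value \<open>\<infinity>\<close> in \<open>ereal\<close>.\<close>
  have fin: "f e x = ereal (real_of_ereal (f e x))" if "e \<in> space M" for e x
    using L(3)[OF that, of x x] by (cases "f e x") auto
  have "(L e)-lipschitz_on UNIV (\<lambda>x. real_of_ereal (f e x))" if "e \<in> space M" for e
  proof (rule lipschitz_onI)
    show "dist (real_of_ereal (f e x)) (real_of_ereal (f e y)) \<le> L e * dist x y" for x y
      using L(3)[OF that, of x y] fin[OF that, of x] fin[OF that, of y]
      by (metis abs_ereal.simps(1) dist_real_def ereal_less_eq(3) ereal_minus(1))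
  qed (use L(2)[OF that] in simp)
  with L fin that show thesis by blast
qed

text \<open>A sublevel set of \<open>g\<close> consists of those \<open>e\<close> whose epigraph
  meets the closed vertical half-line \<open>{x} \<times> {..a}\<close>.\<close>

lemma normal_integrand_measurable:
  assumes f: "normal_integrand M f"
    and fin: "\<And>e. e \<in> space M \<Longrightarrow> f e x = ereal (g e)"
  shows "g \<in> borel_measurable M"
  unfolding borel_measurable_iff_le
proof
  fix a :: real
  have *: "Defs.epigraph (f e) \<inter> {x} \<times> {..a} \<noteq> {} \<longleftrightarrow> g e \<le> a" if "e \<in> space M" for e
  proof
    assume "g e \<le> a"
    then have "(x, a) \<in> Defs.epigraph (f e) \<inter> {x} \<times> {..a}"
      using fin[OF that] by (simp add: Defs.epigraph_def)
    then show "Defs.epigraph (f e) \<inter> {x} \<times> {..a} \<noteq> {}" by blast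
  qed (use fin[OF that] in \<open>auto simp: Defs.epigraph_def\<close>)
  have "closed ({x} \<times> {..a})" by (intro closed_Times) auto
  then have "{e \<in> space M. Defs.epigraph (f e) \<inter> {x} \<times> {..a} \<noteq> {}} \<in> sets M"
    using f unfolding normal_integrand_def by blast
  also have "{e \<in> space M. Defs.epigraph (f e) \<inter> {x} \<times> {..a} \<noteq> {}} = {e \<in> space M. g e \<le> a}"
    using * by auto
  finally show "{e \<in> space M. g e \<le> a} \<in> sets M" .
qed

text \<open>Integrability makes the positive and the negative part finite, so the difference in
  \<open>ereal_integral\<close> is one of real numbers.\<close>

lemma ereal_integral_eq_integral:
  assumes fin: "\<And>e. e \<in> space M \<Longrightarrow> f e = ereal (g e)" and int: "integrable M g"
  shows "ereal_integral M f = ereal (\<integral>e. g e \<partial>M)"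
proof -
  have "(\<integral>\<^sup>+ e. e2ennreal (f e) \<partial>M) = (\<integral>\<^sup>+ e. ennreal (g e) \<partial>M)"
    "(\<integral>\<^sup>+ e. e2ennreal (- f e) \<partial>M) = (\<integral>\<^sup>+ e. ennreal (- g e) \<partial>M)"
    using fin by (auto intro!: nn_integral_cong simp: e2ennreal_ereal)
  moreover have "(\<integral>\<^sup>+ e. ennreal (g e) \<partial>M) \<noteq> \<infinity>" "(\<integral>\<^sup>+ e. ennreal (- g e) \<partial>M) \<noteq> \<infinity>"
    using int by (auto simp: real_integrable_def)
  ultimately show ?thesis
    unfolding ereal_integral_def real_lebesgue_integral_def[OF int]
    by (cases "\<integral>\<^sup>+ e. ennreal (g e) \<partial>M"; cases "\<integral>\<^sup>+ e. ennreal (- g e) \<partial>M")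
      (auto simp: enn2ereal_ennreal)
qed

lemma geodesically_convex_integral:
  assumes conv: "\<And>e. e \<in> space M \<Longrightarrow> geodesically_convex (\<lambda>x. ereal (g e x))"
    and int: "\<And>x. integrable M (\<lambda>e. g e x)"
  shows "geodesically_convex (\<lambda>x. ereal (\<integral>e. g e x \<partial>M))"
  unfolding geodesically_convex_def
proof (intro allI impI, elim conjE)
  fix l t :: real and \<gamma> :: "real \<Rightarrow> 'b"
  assume *: "geodesic l \<gamma>" "0 \<le> t" "t \<le> 1"
  have "(\<integral>e. g e (\<gamma> (t * l)) \<partial>M) \<le> (\<integral>e. (1 - t) * g e (\<gamma> 0) + t * g e (\<gamma> l) \<partial>M)"
    using geodesically_convexD[OF conv *] int
    by (intro integral_mono Bochner_Integration.integrable_add integrable_mult_right) auto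
  also have "\<dots> = (1 - t) * (\<integral>e. g e (\<gamma> 0) \<partial>M) + t * (\<integral>e. g e (\<gamma> l) \<partial>M)"
    using int by simp
  finally show "ereal (\<integral>e. g e (\<gamma> (t * l)) \<partial>M) \<le>
      ereal (1 - t) * ereal (\<integral>e. g e (\<gamma> 0) \<partial>M) + ereal t * ereal (\<integral>e. g e (\<gamma> l) \<partial>M)"
    by simp
qed

lemma lipschitz_on_integral:
  fixes g :: "'e \<Rightarrow> 'a::metric_space \<Rightarrow> real"
  assumes lip: "\<And>e. e \<in> space M \<Longrightarrow> (L e)-lipschitz_on UNIV (g e)"
    and int: "\<And>x. integrable M (\<lambda>e. g e x)" and L: "integrable M L"
  shows "(\<integral>e. L e \<partial>M)-lipschitz_on UNIV (\<lambda>x. \<integral>e. g e x \<partial>M)"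
proof (rule lipschitz_onI)
  fix x y :: 'a
  have "\<bar>\<integral>e. g e x - g e y \<partial>M\<bar> \<le> (\<integral>e. \<bar>g e x - g e y\<bar> \<partial>M)"
    by (rule integral_abs_bound)
  also have "\<dots> \<le> (\<integral>e. L e * dist x y \<partial>M)"
    using lipschitz_onD[OF lip, of _ x y] int L
    by (intro integral_mono integrable_abs Bochner_Integration.integrable_diff integrable_mult_left)
      (auto simp: dist_real_def)
  finally show "dist (\<integral>e. g e x \<partial>M) (\<integral>e. g e y \<partial>M) \<le> (\<integral>e. L e \<partial>M) * dist x y"
    using int by (simp add: dist_real_def)
qed (use lipschitz_on_nonneg[OF lip] in \<open>auto intro: integral_nonneg_AE\<close>)

theorem theorem7p10:
  fixes P :: "'w measure" and M :: "'e measure"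
    and \<xi> :: "nat \<Rightarrow> 'w \<Rightarrow> 'e"
    and f :: "'e \<Rightarrow> 'h::hadamard_space \<Rightarrow> ereal"
    and u0 :: 'h
  assumes "prob_space P"
    and "prob_space M" and "complete_measure M"
    and "locally compact (UNIV :: 'h set)"
    and "prob_space.indep_vars P (\<lambda>_. M) \<xi> {1..}"
    and "\<And>i. 1 \<le> i \<Longrightarrow> distr P M (\<xi> i) = M"
    and "normal_convex_integrand M f" and "proper_integrand M f"
    and "L1_Lipschitz M f"
    and "real_L1 M (\<lambda>e. f e u0)"
  defines "S \<equiv> gradient_flow (\<lambda>x. ereal_integral M (\<lambda>e. f e x))"
  shows "(\<exists>\<Omega>'\<in>sets P. measure P \<Omega>' = 1 \<and>
            (\<forall>\<omega>\<in>\<Omega>'. \<forall>t\<ge>0. \<forall>x.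
               (\<lambda>n. (prox_cycle (t / (real n)\<^sup>2) (\<lambda>i. f (\<xi> i \<omega>)) n ^^ n) x) \<longlonglongrightarrow> S t x))
       \<and> (\<forall>t\<ge>0. \<forall>x. AE \<omega> in P.
            (\<lambda>n. (prox_cycle (t / (real n)\<^sup>2) (\<lambda>i. f (\<xi> i \<omega>)) n ^^ n) x) \<longlonglongrightarrow> S t x)"
proof -
  interpret P: prob_space P by fact
  interpret M: prob_space M by fact
  have cb: "compact (cball x r)" for x :: 'h and r
    using compact_cball_hadamard assms(4) .
  have normal: "normal_integrand M f" and convex: "\<And>e. e \<in> space M \<Longrightarrow> geodesically_convex (f e)"
    using assms(7) by (auto simp: normal_convex_integrand_def)
  define g where "g = (\<lambda>e x. real_of_ereal (f e x))"
  obtain L where L: "integrable M L" "\<And>e. e \<in> space M \<Longrightarrow> 0 < L e"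
    and fg: "\<And>e x. e \<in> space M \<Longrightarrow> f e x = ereal (g e x)"
    and lip: "\<And>e. e \<in> space M \<Longrightarrow> (L e)-lipschitz_on UNIV (g e)"
    using L1_Lipschitz_real[OF assms(9)] unfolding g_def by blast
  have conv: "geodesically_convex (\<lambda>x. ereal (g e x))" if "e \<in> space M" for e
    using convex[OF that] fg[OF that] by (metis ext)
  have meas: "(\<lambda>e. g e x) \<in> borel_measurable M" for x
    using normal fg by (rule normal_integrand_measurable)
  have int0: "integrable M (\<lambda>e. g e u0)"
    using assms(10) by (simp add: real_L1_def g_def)
  \<comment> \<open>The Lipschitz bound carries integrability from \<open>u0\<close> to every
    \<open>x\<close>.\<close>
  have int: "integrable M (\<lambda>e. g e x)" for x
  proof (rule Bochner_Integration.integrable_bound)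
    show "integrable M (\<lambda>e. \<bar>g e u0\<bar> + L e * dist x u0)"
      using int0 L by auto
    show "AE e in M. norm (g e x) \<le> norm (\<bar>g e u0\<bar> + L e * dist x u0)"
    proof (rule AE_I2)
      fix e assume "e \<in> space M"
      then show "norm (g e x) \<le> norm (\<bar>g e u0\<bar> + L e * dist x u0)"
        using lipschitz_onD[OF lip, of e x u0] by (simp add: dist_real_def)
    qed
  qed (rule meas)
  define F where "F = (\<lambda>x. \<integral>e. g e x \<partial>M)"
  have S: "S = gradient_flow (\<lambda>x. ereal (F x))"
    unfolding S_def F_def using ereal_integral_eq_integral[OF fg int] by (metis (no_types, lifting))
  have F: "geodesically_convex (\<lambda>x. ereal (F x))" "(\<integral>e. L e \<partial>M)-lipschitz_on UNIV F"
    unfolding F_def using geodesically_convex_integral[OF conv int] lipschitz_on_integral[OF lip int L(1)]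
    by auto
  obtain D :: "'h set" where D: "countable D" "closure D = UNIV"
    using separable_if_compact_cballs[OF cb] by blast
  have \<xi>: "\<xi> i \<omega> \<in> space M" if "\<omega> \<in> space P" "1 \<le> i" for i \<omega>
    using assms(5) that by (auto simp: P.indep_vars_def dest: measurable_space)
  note slln = P.iid_strong_law_of_large_numbers[OF assms(5,6,2)]
  \<comment> \<open>A null set independent of \<open>t\<close> and \<open>x\<close> comes from
    countably many uses of the strong law: one for each point of \<open>D\<close> and one for the
    Lipschitz constants.\<close>
  have "AE \<omega> in P. \<forall>x\<in>D. (\<lambda>n. (\<Sum>i=1..n. g (\<xi> i \<omega>) x) / real n) \<longlonglongrightarrow> F x"
    unfolding F_def AE_ball_countable[OF D(1)] by (intro ballI slln int)
  moreover have "AE \<omega> in P. (\<lambda>n. (\<Sum>i=1..n. L (\<xi> i \<omega>)) / real n) \<longlonglongrightarrow> (\<integral>e. L e \<partial>M)"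
    by (intro slln L)
  ultimately have "AE \<omega> in P. \<forall>t\<ge>0. \<forall>x.
      (\<lambda>n. (prox_cycle (t / (real n)\<^sup>2) (\<lambda>i. f (\<xi> i \<omega>)) n ^^ n) x) \<longlonglongrightarrow> S t x"
    using AE_space
  proof eventually_elim
    case (elim \<omega>)
    \<comment> \<open>Convergent averages are bounded for all \<open>n\<close>. The maximum with the
      integral of \<open>L\<close> is then also a Lipschitz constant of \<open>F\<close>, so one
      \<open>K\<close> serves both purposes.\<close>
    obtain B where "\<And>n. \<bar>(\<Sum>i=1..n. L (\<xi> i \<omega>)) / real n\<bar> \<le> B"
      using convergent_imp_Bseq[OF convergentI[OF elim(2)]] by (auto simp: Bseq_def)
    then have K: "(\<Sum>i=1..n. L (\<xi> i \<omega>)) / real n \<le> max B (\<integral>e. L e \<partial>M)" for n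
      by (meson abs_le_D1 max.coboundedI1)
    have eq: "prox_cycle s (\<lambda>i. f (\<xi> i \<omega>)) n = prox_cycle s (\<lambda>i x. ereal (g (\<xi> i \<omega>) x)) n" for s n
      using fg \<xi> elim(3) by (intro prox_cycle_cong ext) auto
    show ?case
      unfolding eq S
    proof (intro allI impI)
      fix t :: real and x assume "t \<ge> 0"
      then show "(\<lambda>n. (prox_cycle (t / (real n)\<^sup>2) (\<lambda>i x. ereal (g (\<xi> i \<omega>) x)) n ^^ n) x)
          \<longlonglongrightarrow> gradient_flow (\<lambda>x. ereal (F x)) t x"
        using cb conv lip \<xi> elim K F(1) lipschitz_on_le[OF F(2), of "max B (\<integral>e. L e \<partial>M)"] D
        by (intro prox_cycles_tendsto_gradient_flow[where K = "max B (\<integral>e. L e \<partial>M)"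
            and L = "\<lambda>i. L (\<xi> i \<omega>)" and D = D]) auto
    qed
  qed
  \<comment> \<open>The complement of a measurable null set containing all exceptional outcomes
    serves as \<open>\<Omega>'\<close>.\<close>
  then obtain N where N: "N \<in> null_sets P" "\<And>\<omega>. \<omega> \<in> space P - N \<Longrightarrow> \<forall>t\<ge>0. \<forall>x.
      (\<lambda>n. (prox_cycle (t / (real n)\<^sup>2) (\<lambda>i. f (\<xi> i \<omega>)) n ^^ n) x) \<longlonglongrightarrow> S t x"
    by (rule AE_E3) blast
  have "measure P (space P - N) = 1"
    using N(1) P.prob_compl[of N] by (auto simp: null_sets_def measure_def)
  with N have ex: "\<exists>\<Omega>'\<in>sets P. measure P \<Omega>' = 1 \<and> (\<forall>\<omega>\<in>\<Omega>'. \<forall>t\<ge>0. \<forall>x.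
      (\<lambda>n. (prox_cycle (t / (real n)\<^sup>2) (\<lambda>i. f (\<xi> i \<omega>)) n ^^ n) x) \<longlonglongrightarrow> S t x)"
    by (intro bexI[of _ "space P - N"]) auto
  moreover have "\<forall>t\<ge>0. \<forall>x. AE \<omega> in P.
      (\<lambda>n. (prox_cycle (t / (real n)\<^sup>2) (\<lambda>i. f (\<xi> i \<omega>)) n ^^ n) x) \<longlonglongrightarrow> S t x"
    using N by (intro allI impI AE_I'[of N]) auto
  ultimately show ?thesis by blast
qed

end
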